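(* Let $F\in C^3(\Omega)$ and let $u\in C^5([t_0,T])$ be the unique solution of $u'(t)=F(t,u(t))$, $t\in(t_0,T)$, $u(t_0)=u_0$. Suppose that there exist constants $\rho>0$ and $L\ge0$ such that $U_\rho(u)\subset\Omega$ and $|F(t,x)-F(t,y)|\le L|x-y|$ whenever $(t,x),(t,y)\in U_\rho(u)$. Suppose further that there exists $\varepsilon_0>0$ such that, whenever $(t,x),(s,y)\in U_\rho(u)$ and $0\le s-t\le\varepsilon_0$, the coefficients $A,B,C,D$ associated with the pair $(t,x),(s,y)$ satisfy $A\ne0$ and either (E5a) $D>0$, $AB<0$, and $AC=0$, or (E5b) $D>0$ and $AC<0$. Define $$\Sigma(t,x;s,y):=\left(\frac{-B+\operatorname{sgn}(A)\sqrt{D}}{2A}\right)^{1/2}$$ for every such pair of points. Consider the specular ellipse method with $$\sigma_n:=\Sigma(t_n,u_n;t_{n+1},u_{n+1}),\qquad n=0,1,\ldots,N_h-1.$$ Then there exist constants $H>0$ (with $H\le\varepsilon_0$, so that the scales are defined) and $C_g>0$ such that, for every $h\in(0,H]$, there exists a unique sequence $\{u_n\}_{n=0}^{N_h}$ with $u_0=u(t_0)$ satisfying $$u_{n+1}=u_n+h\,\mathcal{C}_{\sigma_n}\bigl(F(t_{n+1},u_{n+1}),F(t_n,u_n)\bigr),\qquad n=0,1,\ldots,N_h-1,$$ with these scales and $\{(t_n,u_n)\}_{n=0}^{N_h}\subseteq U_\rho(u)$, and this sequence satisfies $$\max_{0\le n\le N_h}|u(t_n)-u_n|\le C_gh^4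.$$
   Context: Let $\Omega\subset\mathbb{R}^2$ be open, $F:\Omega\to\mathbb{R}$, $t_0\ge 0$, $T>t_0$, $u_0\in\mathbb{R}$ with $(t_0,u_0)\in\Omega$. A solution $u:[t_0,T]\to\mathbb{R}$ satisfies $(t,u(t))\in\Omega$ for every $t\in[t_0,T]$. For $\rho>0$, $U_\rho(u):=\{(t,x)\in[t_0,T]\times\mathbb{R}: |x-u(t)|\le\rho\}$. For $h>0$ put $N_h:=\lfloor h^{-1}(T-t_0)\rfloor$ and $t_n:=t_0+nh$. For $G\in C^1(\Omega)$, $\mathcal{L}_FG:=G_t+FG_x$; for $G\in C^2(\Omega)$, $\mathcal{L}_F^2G:=\mathcal{L}_F(\mathcal{L}_FG)$. For a pair $(t,x),(s,y)\in\Omega$ put $$a:=\mathcal{L}_F^2F(t,x),\quad b:=3F(t,x)\bigl(\mathcal{L}_FF(t,x)\bigr)^2,\quad c:=F(t,x)^2,$$ $$d:=\mathcal{L}_F^2F(s,y),\quad e:=3F(s,y)\bigl(\mathcal{L}_FF(s,y)\bigr)^2,\quad f:=F(s,y)^2,$$ $$A:=a+d,\quad B:=(a+d)(c+f)-b-e,\quad C:=(a+d)cf-bf-ec,\quad D:=B^2-4AC.$$ For $\sigma>0$ define $\mathcal{C}_\sigma(\alpha,\beta):=\sigma\,\mathcal{C}(\alpha/\sigma,\beta/\sigma)$, where (as a function of two real variables) $$\mathcal{C}(\alpha,\beta):=\left(\frac{\alpha}{\sqrt{1+\alpha^2}}+\frac{\beta}{\sqrt{1+\beta^2}}\right)\left(\frac{1}{\sqrt{1+\alpha^2}}+\frac{1}{\sqrt{1+\beta^2}}\right)^{-1}.$$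 $\operatorname{sgn}$ is the sign function. *)

theory Defs
  imports "HOL-Analysis.Analysis"
begin

definition partial_t :: "(real \<times> real \<Rightarrow> real) \<Rightarrow> real \<times> real \<Rightarrow> real" where
  "partial_t G p = deriv (\<lambda>t. G (t, snd p)) (fst p)"

definition partial_x :: "(real \<times> real \<Rightarrow> real) \<Rightarrow> real \<times> real \<Rightarrow> real" where
  "partial_x G p = deriv (\<lambda>x. G (fst p, x)) (snd p)"

(* G is k times continuously differentiable on S; intended for open S only. *)
fun Ck_plane :: "nat \<Rightarrow> (real \<times> real \<Rightarrow> real) \<Rightarrow> (real \<times> real) set \<Rightarrow> bool" where
  "Ck_plane 0 G S \<longleftrightarrow> continuous_on S G"
| "Ck_plane (Suc k) G S \<longleftrightarrow> continuous_on S G \<and>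
     (\<forall>p\<in>S. (\<lambda>t. G (t, snd p)) differentiable (at (fst p)) \<and>
            (\<lambda>x. G (fst p, x)) differentiable (at (snd p))) \<and>
     Ck_plane k (partial_t G) S \<and> Ck_plane k (partial_x G) S"

(* k times continuously differentiable on [a,b], with one-sided derivatives at the end points.
   For a < b the witness g' is determined on [a,b]. *)
fun Ck_interval :: "nat \<Rightarrow> (real \<Rightarrow> real) \<Rightarrow> real \<Rightarrow> real \<Rightarrow> bool" where
  "Ck_interval 0 g a b \<longleftrightarrow> continuous_on {a..b} g"
| "Ck_interval (Suc k) g a b \<longleftrightarrow>
     (\<exists>g'. (\<forall>t\<in>{a..b}. (g has_real_derivative g' t) (at t within {a..b})) \<and>
           Ck_interval k g' a b)"

definition ivp_solution ::
  "(real \<times> real) set \<Rightarrow> (real \<times> real \<Rightarrow> real) \<Rightarrow> real \<Rightarrow> real \<Rightarrow> real \<Rightarrow> (real \<Rightarrow> real) \<Rightarrow> bool" where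
  "ivp_solution \<Omega> F t0 T u0 u \<longleftrightarrow>
     continuous_on {t0..T} u \<and>
     (\<forall>t\<in>{t0..T}. (t, u t) \<in> \<Omega>) \<and>
     (\<forall>t\<in>{t0<..<T}. (u has_real_derivative F (t, u t)) (at t)) \<and>
     u t0 = u0"

definition tube :: "real \<Rightarrow> real \<Rightarrow> real \<Rightarrow> (real \<Rightarrow> real) \<Rightarrow> (real \<times> real) set" where
  "tube t0 T \<rho> u = {(t, x). t \<in> {t0..T} \<and> \<bar>x - u t\<bar> \<le> \<rho>}"

(* The derivative of G along the flow of x' = F(t,x). *)
definition Lie :: "(real \<times> real \<Rightarrow> real) \<Rightarrow> (real \<times> real \<Rightarrow> real) \<Rightarrow> real \<times> real \<Rightarrow> real" where
  "Lie F G p = partial_t G p + F p * partial_x G p"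

definition coeff_a :: "(real \<times> real \<Rightarrow> real) \<Rightarrow> real \<times> real \<Rightarrow> real" where
  "coeff_a F p = Lie F (Lie F F) p"

definition coeff_b :: "(real \<times> real \<Rightarrow> real) \<Rightarrow> real \<times> real \<Rightarrow> real" where
  "coeff_b F p = 3 * F p * (Lie F F p)\<^sup>2"

definition coeff_c :: "(real \<times> real \<Rightarrow> real) \<Rightarrow> real \<times> real \<Rightarrow> real" where
  "coeff_c F p = (F p)\<^sup>2"

(* For a pair p = (t,x), q = (s,y), the numbers d, e, f are coeff_a, coeff_b, coeff_c at q. *)
definition coeff_A :: "(real \<times> real \<Rightarrow> real) \<Rightarrow> real \<times> real \<Rightarrow> real \<times> real \<Rightarrow> real" where
  "coeff_A F p q = coeff_a F p + coeff_a F q"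

definition coeff_B :: "(real \<times> real \<Rightarrow> real) \<Rightarrow> real \<times> real \<Rightarrow> real \<times> real \<Rightarrow> real" where
  "coeff_B F p q =
     (coeff_a F p + coeff_a F q) * (coeff_c F p + coeff_c F q) - coeff_b F p - coeff_b F q"

definition coeff_C :: "(real \<times> real \<Rightarrow> real) \<Rightarrow> real \<times> real \<Rightarrow> real \<times> real \<Rightarrow> real" where
  "coeff_C F p q =
     (coeff_a F p + coeff_a F q) * coeff_c F p * coeff_c F q
       - coeff_b F p * coeff_c F q - coeff_b F q * coeff_c F p"

definition coeff_D :: "(real \<times> real \<Rightarrow> real) \<Rightarrow> real \<times> real \<Rightarrow> real \<times> real \<Rightarrow> real" where
  "coeff_D F p q = (coeff_B F p q)\<^sup>2 - 4 * coeff_A F p q * coeff_C F p q"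

definition Sigma_scale :: "(real \<times> real \<Rightarrow> real) \<Rightarrow> real \<times> real \<Rightarrow> real \<times> real \<Rightarrow> real" where
  "Sigma_scale F p q =
     sqrt ((- coeff_B F p q + sgn (coeff_A F p q) * sqrt (coeff_D F p q)) / (2 * coeff_A F p q))"

definition specular_mean :: "real \<Rightarrow> real \<Rightarrow> real" where
  "specular_mean \<alpha> \<beta> =
     (\<alpha> / sqrt (1 + \<alpha>\<^sup>2) + \<beta> / sqrt (1 + \<beta>\<^sup>2)) *
     inverse (1 / sqrt (1 + \<alpha>\<^sup>2) + 1 / sqrt (1 + \<beta>\<^sup>2))"

(* Intended for \<sigma> > 0 only. *)
definition scaled_mean :: "real \<Rightarrow> real \<Rightarrow> real \<Rightarrow> real" where
  "scaled_mean \<sigma> \<alpha> \<beta> = \<sigma> * specular_mean (\<alpha> / \<sigma>) (\<beta> / \<sigma>)"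

definition num_steps :: "real \<Rightarrow> real \<Rightarrow> real \<Rightarrow> nat" where
  "num_steps t0 T h = nat \<lfloor>inverse h * (T - t0)\<rfloor>"

definition grid :: "real \<Rightarrow> real \<Rightarrow> nat \<Rightarrow> real" where
  "grid t0 h n = t0 + real n * h"

(* v 0, ..., v N is a run of the specular ellipse method with scales \<sigma> 0, ..., \<sigma> (N - 1);
   other values of v and \<sigma> are irrelevant. *)
definition ellipse_method ::
  "(real \<times> real \<Rightarrow> real) \<Rightarrow> real \<Rightarrow> real \<Rightarrow> nat \<Rightarrow> (nat \<Rightarrow> real) \<Rightarrow> (nat \<Rightarrow> real) \<Rightarrow> bool" where
  "ellipse_method F t0 h N \<sigma> v \<longleftrightarrow>
     (\<forall>n<N. v (Suc n) = v n + h * scaled_mean (\<sigma> n)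
        (F (grid t0 h (Suc n), v (Suc n))) (F (grid t0 h n, v n)))"

(* The scales depend on the sequence itself, so each step is implicit in v (Suc n) through
   both F and the scale. *)
definition adaptive_run ::
  "(real \<times> real \<Rightarrow> real) \<Rightarrow> real \<Rightarrow> real \<Rightarrow> real \<Rightarrow> (real \<Rightarrow> real) \<Rightarrow> real \<Rightarrow> (nat \<Rightarrow> real) \<Rightarrow> bool" where
  "adaptive_run F t0 T \<rho> u h v \<longleftrightarrow>
     v 0 = u t0 \<and>
     ellipse_method F t0 h (num_steps t0 T h)
       (\<lambda>n. Sigma_scale F (grid t0 h n, v n) (grid t0 h (Suc n), v (Suc n))) v \<and>
     (\<forall>n\<le>num_steps t0 T h. (grid t0 h n, v n) \<in> tube t0 T \<rho> u)"

end

theory Submission imports Defs begin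

text \<open>
  Write \<open>m\<close> for the arithmetic mean of \<open>\<alpha>\<close> and \<open>\<beta>\<close>, and \<open>R x = sqrt (\<sigma>\<^sup>2 + x\<^sup>2)\<close>. The scaled mean
  of \<open>\<alpha>\<close> and \<open>\<beta>\<close> is \<open>m - m (\<alpha> - \<beta>)\<^sup>2 / (R \<alpha> + R \<beta>)\<^sup>2\<close>. For \<open>\<alpha> = u'(t + h)\<close> and \<open>\<beta> = u'(t)\<close> the
  subtracted term is, up to \<open>O(h\<^sup>4)\<close>, \<open>h\<^sup>2/8\<close> times the sum of \<open>u' u''\<^sup>2 / (\<sigma>\<^sup>2 + u'\<^sup>2)\<close> over the two
  end points, while the defect of the trapezoidal rule is \<open>- h\<^sup>3/24\<close> times the sum of \<open>u'''\<close> up to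
  \<open>O(h\<^sup>5)\<close>. That \<open>\<sigma>\<^sup>2\<close> is a root of \<open>A X\<^sup>2 + B X + C\<close> says exactly that these two terms cancel, so
  the local error is \<open>O(h\<^sup>5)\<close>.

  On the compact set of admissible pairs of points of the tube, \<open>\<bar>A\<bar>\<close>, \<open>D\<close> and \<open>\<sigma>\<^sup>2\<close> are bounded away
  from zero, so the increment is Lipschitz in \<open>(x, y)\<close> for fixed times. For small \<open>h\<close> each step is
  therefore a contraction of a fibre of the tube, and the errors accumulate as in a discrete
  Gronwall inequality.
\<close>

subsection \<open>Implicit one-step methods\<close>

lemma grid_mem:
  assumes "0 < h" "n \<le> num_steps t0 T h" "t0 \<le> T"
  shows "grid t0 h n \<in> {t0..T}"
proof -
  have nn: "0 \<le> inverse h * (T - t0)" using assms by simp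
  have "real n \<le> real (num_steps t0 T h)" using assms by simp
  also have "\<dots> \<le> inverse h * (T - t0)"
    unfolding num_steps_def using nn by (simp add: of_nat_floor)
  finally have "real n * h \<le> T - t0"
    using assms(1) by (simp add: field_simps)
  then show ?thesis using assms by (simp add: grid_def)
qed

text \<open>The difference of two fixed points is shrunk by the factor \<open>h * M < 1\<close>, so
  it vanishes.\<close>

lemma implicit_step_unique:
  fixes x h M c \<rho> :: real and \<phi> :: "real \<Rightarrow> real"
  assumes lip: "\<And>y z. \<bar>y - c\<bar> \<le> \<rho> \<Longrightarrow> \<bar>z - c\<bar> \<le> \<rho> \<Longrightarrow> \<bar>\<phi> y - \<phi> z\<bar> \<le> M * \<bar>y - z\<bar>"
    and hM: "0 \<le> h" "h * M < 1"
    and y: "\<bar>y - c\<bar> \<le> \<rho>" "y = x + h * \<phi> y"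
    and z: "\<bar>z - c\<bar> \<le> \<rho>" "z = x + h * \<phi> z"
  shows "y = z"
proof (rule ccontr)
  assume "y \<noteq> z"
  have "\<bar>y - z\<bar> = \<bar>h * (\<phi> y - \<phi> z)\<bar>"
    using y(2) z(2) by (simp add: algebra_simps)
  also have "\<dots> = h * \<bar>\<phi> y - \<phi> z\<bar>" using hM by (simp add: abs_mult)
  also have "\<dots> \<le> h * (M * \<bar>y - z\<bar>)"
    using lip[OF y(1) z(1)] hM by (intro mult_left_mono) auto
  also have "\<dots> = (h * M) * \<bar>y - z\<bar>" by simp
  also have "\<dots> < 1 * \<bar>y - z\<bar>"
    using hM \<open>y \<noteq> z\<close> by (intro mult_strict_right_mono) auto
  finally show False by simp
qed

text \<open>Banach's fixed point theorem on the closed interval of radius \<rho> about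
  \<open>c\<close>; \<open>self\<close> makes this complete set invariant.\<close>

lemma implicit_step_exists:
  fixes x h M c \<rho> :: real and \<phi> :: "real \<Rightarrow> real"
  assumes lip: "\<And>y z. \<bar>y - c\<bar> \<le> \<rho> \<Longrightarrow> \<bar>z - c\<bar> \<le> \<rho> \<Longrightarrow> \<bar>\<phi> y - \<phi> z\<bar> \<le> M * \<bar>y - z\<bar>"
    and hM: "0 \<le> h" "0 \<le> M" "h * M < 1" and "0 \<le> \<rho>"
    and self: "\<And>y. \<bar>y - c\<bar> \<le> \<rho> \<Longrightarrow> \<bar>x + h * \<phi> y - c\<bar> \<le> \<rho>"
  shows "\<exists>y. \<bar>y - c\<bar> \<le> \<rho> \<and> y = x + h * \<phi> y"
proof -
  have mem: "y \<in> cball c \<rho> \<longleftrightarrow> \<bar>y - c\<bar> \<le> \<rho>" for y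
    by (auto simp: dist_real_def abs_minus_commute)
  have "\<exists>!y\<in>cball c \<rho>. x + h * \<phi> y = y"
  proof (rule Banach_fix[where c = "h * M"])
    show "dist (x + h * \<phi> y) (x + h * \<phi> z) \<le> h * M * dist y z"
      if "y \<in> cball c \<rho>" "z \<in> cball c \<rho>" for y z
    proof -
      have "dist (x + h * \<phi> y) (x + h * \<phi> z) = h * \<bar>\<phi> y - \<phi> z\<bar>"
        using hM by (simp add: dist_real_def abs_mult flip: right_diff_distrib)
      also have "\<dots> \<le> h * (M * \<bar>y - z\<bar>)"
        using that hM lip unfolding mem by (intro mult_left_mono) auto
      finally show ?thesis by (simp add: dist_real_def mult.assoc)
    qed
  qed (use assms in \<open>auto simp: complete_eq_closed mem simp del: mem_cball\<close>)
  then show ?thesis unfolding mem by metis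
qed

text \<open>The new error \<open>e'\<close> stands on both sides because the step is implicit. For
  \<open>x \<le> 1/4\<close> one has \<open>(1 + x) / (1 - x) \<le> 1 + 4 * x\<close> and
  \<open>1 / (1 - x) \<le> 2\<close>, which makes the recursion explicit.\<close>

lemma one_step_error:
  fixes e e' :: real
  assumes "e' \<le> e + x * (e + e') + k" "0 \<le> x" "x \<le> 1/4" "0 \<le> e" "0 \<le> k"
  shows "e' \<le> (1 + 4 * x) * e + 2 * k"
proof -
  have "(1 - x) * e' \<le> (1 + x) * e + k" using assms by (simp add: algebra_simps)
  also have "\<dots> \<le> (1 - x) * ((1 + 4 * x) * e + 2 * k)"
  proof -
    have "(1 + x) * e \<le> ((1 - x) * (1 + 4 * x)) * e"
    proof (rule mult_right_mono)
      have "0 \<le> x * (2 - 4 * x)" using assms by (intro mult_nonneg_nonneg) auto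
      then show "1 + x \<le> (1 - x) * (1 + 4 * x)" by (simp add: algebra_simps)
    qed (use assms in simp)
    moreover have "1 * k \<le> ((1 - x) * 2) * k"
      using assms by (intro mult_right_mono) auto
    ultimately show ?thesis by (simp add: algebra_simps)
  qed
  finally show ?thesis using assms by (simp add: mult_le_cancel_left)
qed

text \<open>Stability and consistency give convergence for any increment function \<Phi>. The error
  bound does double duty: it keeps the computed values within \<rho>/4 of the solution, so that the
  next implicit equation is again a contraction of a fibre of the tube. Uniqueness is meant among
  runs that stay in the tube.\<close>

theorem implicit_one_step_convergence:
  fixes \<Phi> :: "real \<times> real \<Rightarrow> real \<times> real \<Rightarrow> real" and u :: "real \<Rightarrow> real"
    and t0 T \<rho> \<epsilon> M K :: real and p :: nat
  assumes T: "t0 < T" and \<rho>: "0 < \<rho>" and \<epsilon>: "0 < \<epsilon>" and M: "0 \<le> M" and K: "0 \<le> K" and p: "0 < p"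
    and lip: "\<And>t s x y x' y'. (t, x) \<in> tube t0 T \<rho> u \<Longrightarrow> (s, y) \<in> tube t0 T \<rho> u \<Longrightarrow>
        (t, x') \<in> tube t0 T \<rho> u \<Longrightarrow> (s, y') \<in> tube t0 T \<rho> u \<Longrightarrow> 0 \<le> s - t \<Longrightarrow> s - t \<le> \<epsilon> \<Longrightarrow>
        \<bar>\<Phi> (t, x) (s, y) - \<Phi> (t, x') (s, y')\<bar> \<le> M * (\<bar>x - x'\<bar> + \<bar>y - y'\<bar>)"
    and consistent: "\<And>t h. 0 < h \<Longrightarrow> h \<le> \<epsilon> \<Longrightarrow> t0 \<le> t \<Longrightarrow> t + h \<le> T \<Longrightarrow>
        \<bar>u (t + h) - u t - h * \<Phi> (t, u t) (t + h, u (t + h))\<bar> \<le> K * h ^ Suc p"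
  defines "run \<equiv> \<lambda>h v. v 0 = u t0 \<and>
      (\<forall>n<num_steps t0 T h. v (Suc n) =
         v n + h * \<Phi> (grid t0 h n, v n) (grid t0 h (Suc n), v (Suc n))) \<and>
      (\<forall>n\<le>num_steps t0 T h. (grid t0 h n, v n) \<in> tube t0 T \<rho> u)"
  shows "\<exists>H C. 0 < H \<and> H \<le> \<epsilon> \<and> 0 < C \<and> (\<forall>h. 0 < h \<and> h \<le> H \<longrightarrow>
      (\<exists>v. run h v \<and> (\<forall>w. run h w \<longrightarrow> (\<forall>n\<le>num_steps t0 T h. w n = v n)) \<and>
           (\<forall>n\<le>num_steps t0 T h. \<bar>u (grid t0 h n) - v n\<bar> \<le> C * h ^ p)))"
proof -
  \<comment> \<open>The first summand bounds the majorant \<open>E\<close> below, using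
    \<open>real n * h \<le> T - t0\<close>; the summand 1 keeps \<open>C\<close> positive when
    \<open>K = 0\<close>.\<close>
  define C where "C = 2 * K * (T - t0) * exp (4 * M * (T - t0)) + 1"
  have C: "0 < C" unfolding C_def using K T by (simp add: add_nonneg_pos)
  \<comment> \<open>In order, the entries give: access to \<open>lip\<close> and
    \<open>consistent\<close>, \<open>h ^ p \<le> h\<close>, the contraction bound
    \<open>h * M \<le> 1/4\<close>, and the bound \<rho>/4 for both \<open>C * h ^ p\<close> and
    \<open>K * h ^ Suc p\<close>.\<close>
  define H where "H = Min {\<epsilon>, 1, 1 / (4 * M + 1), \<rho> / (4 * (C + K + 1))}"
  have H: "0 < H" "H \<le> \<epsilon>" "H \<le> 1" "H \<le> 1 / (4 * M + 1)" "H \<le> \<rho> / (4 * (C + K + 1))"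
    unfolding H_def using \<epsilon> M \<rho> C K by auto
  have "\<exists>v. run h v \<and> (\<forall>w. run h w \<longrightarrow> (\<forall>n\<le>num_steps t0 T h. w n = v n)) \<and>
           (\<forall>n\<le>num_steps t0 T h. \<bar>u (grid t0 h n) - v n\<bar> \<le> C * h ^ p)"
    if h: "0 < h" "h \<le> H" for h
  proof -
    define N where "N = num_steps t0 T h"
    define g where "g = grid t0 h"
    have g0: "g 0 = t0" and gS: "g (Suc n) = g n + h" for n
      unfolding g_def grid_def by (auto simp: algebra_simps)
    have g_mem: "t0 \<le> g n" "g n \<le> T" if "n \<le> N" for n
      using grid_mem[of h n t0 T] that h T by (auto simp: N_def g_def)
    have hle: "h \<le> \<epsilon>" "h \<le> 1" using h H by auto
    have hM: "h * M \<le> 1/4"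
    proof -
      have "h * M \<le> 1 / (4 * M + 1) * M" using h H M by (intro mult_right_mono) auto
      also have "\<dots> \<le> 1/4" using M by (simp add: field_simps)
      finally show ?thesis .
    qed
    have hCK: "h * (C + K + 1) \<le> \<rho> / 4"
    proof -
      have "h * (C + K + 1) \<le> \<rho> / (4 * (C + K + 1)) * (C + K + 1)"
        using h H C K by (intro mult_right_mono) auto
      also have "\<dots> = \<rho> / 4" using C K by (simp add: field_simps)
      finally show ?thesis .
    qed
    have hp: "h ^ p \<le> h" using power_decreasing[of 1 p h] h hle p by simp
    have hC: "C * h ^ p \<le> \<rho> / 4" and hK: "K * h ^ Suc p \<le> \<rho> / 4"
    proof -
      have "C * h ^ p \<le> (C + K + 1) * h" using hp C K h by (intro mult_mono) auto
      then show "C * h ^ p \<le> \<rho> / 4" using hCK by (simp add: mult.commute)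
      have "h ^ Suc p \<le> h" using power_decreasing[of 1 "Suc p" h] h hle by simp
      then have "K * h ^ Suc p \<le> (C + K + 1) * h" using C K h by (intro mult_mono) auto
      then show "K * h ^ Suc p \<le> \<rho> / 4" using hCK by (simp add: mult.commute)
    qed
    have tubeI: "(g n, x) \<in> tube t0 T \<rho> u" if "n \<le> N" "\<bar>x - u (g n)\<bar> \<le> \<rho>" for n x
      using that g_mem by (auto simp: tube_def)
    have tubeD: "\<bar>x - u t\<bar> \<le> \<rho>" if "(t, x) \<in> tube t0 T \<rho> u" for t x
      using that by (auto simp: tube_def)
    have lip2: "\<bar>\<Phi> (g n, x) (g (Suc n), y) - \<Phi> (g n, x') (g (Suc n), y')\<bar> \<le> M * (\<bar>x - x'\<bar> + \<bar>y - y'\<bar>)"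
      if "Suc n \<le> N" "\<bar>x - u (g n)\<bar> \<le> \<rho>" "\<bar>x' - u (g n)\<bar> \<le> \<rho>"
        "\<bar>y - u (g (Suc n))\<bar> \<le> \<rho>" "\<bar>y' - u (g (Suc n))\<bar> \<le> \<rho>" for n x y x' y'
      using that h hle by (intro lip tubeI) (auto simp: gS)
    have lip_y: "\<bar>\<Phi> (g n, x) (g (Suc n), y) - \<Phi> (g n, x) (g (Suc n), y')\<bar> \<le> M * \<bar>y - y'\<bar>"
      if "Suc n \<le> N" "\<bar>x - u (g n)\<bar> \<le> \<rho>"
        "\<bar>y - u (g (Suc n))\<bar> \<le> \<rho>" "\<bar>y' - u (g (Suc n))\<bar> \<le> \<rho>" for n x y y'
      using lip2[of n x x y y'] that by simp
    \<comment> \<open>Used twice: for arbitrary \<open>y\<close> it shows that the fixed point map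
      preserves the fibre, and for the fixed point itself it is the error recursion.\<close>
    have defect: "\<bar>x + h * \<Phi> (g n, x) (g (Suc n), y) - u (g (Suc n))\<bar>
        \<le> \<bar>x - u (g n)\<bar> + h * M * (\<bar>x - u (g n)\<bar> + \<bar>y - u (g (Suc n))\<bar>) + K * h ^ Suc p"
      if "Suc n \<le> N" "\<bar>x - u (g n)\<bar> \<le> \<rho>" "\<bar>y - u (g (Suc n))\<bar> \<le> \<rho>" for n x y
    proof -
      let ?P = "\<Phi> (g n, x) (g (Suc n), y)" and ?Q = "\<Phi> (g n, u (g n)) (g (Suc n), u (g (Suc n)))"
      have 1: "\<bar>u (g (Suc n)) - u (g n) - h * ?Q\<bar> \<le> K * h ^ Suc p"
        using consistent[of h "g n"] g_mem[of n] g_mem[of "Suc n"] h hle that by (simp add: gS)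
      have "h * \<bar>?P - ?Q\<bar> \<le> h * (M * (\<bar>x - u (g n)\<bar> + \<bar>y - u (g (Suc n))\<bar>))"
        using lip2[of n x "u (g n)" y "u (g (Suc n))"] that h \<rho> by (intro mult_left_mono) auto
      then have 2: "\<bar>h * (?P - ?Q)\<bar> \<le> h * M * (\<bar>x - u (g n)\<bar> + \<bar>y - u (g (Suc n))\<bar>)"
        using h by (simp add: abs_mult mult.assoc)
      have "x + h * ?P - u (g (Suc n)) = (x - u (g n)) + h * (?P - ?Q)
          - (u (g (Suc n)) - u (g n) - h * ?Q)" by (simp add: algebra_simps)
      then show ?thesis using 1 2 by linarith
    qed
    \<comment> \<open>A closed majorant of the recursion from \<open>one_step_error\<close>: each of
      the \<open>n\<close> local errors is charged with the full growth factor. The factor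
      \<open>real n\<close> absorbs one power of \<open>h\<close>, hence the loss of one
      order.\<close>
    define E where "E n = real n * (2 * (K * h ^ Suc p)) * (1 + 4 * (h * M)) ^ n" for n
    have EC: "E n \<le> C * h ^ p" if "n \<le> N" for n
    proof -
      have nh: "real n * h \<le> T - t0" using g_mem(2)[OF that] by (simp add: g_def grid_def)
      have "(1 + 4 * (h * M)) ^ n \<le> exp (4 * (h * M)) ^ n"
        using M h by (intro power_mono exp_ge_add_one_self) auto
      also have "\<dots> = exp (4 * M * (real n * h))"
        by (simp add: exp_of_nat_mult[symmetric] mult_ac)
      also have "\<dots> \<le> exp (4 * M * (T - t0))" using nh M by (simp add: mult_left_mono)
      finally have 1: "(1 + 4 * (h * M)) ^ n \<le> exp (4 * M * (T - t0))" .
      have "E n = (2 * K * (real n * h)) * (1 + 4 * (h * M)) ^ n * h ^ p"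
        by (simp add: E_def)
      also have "\<dots> \<le> (2 * K * (T - t0)) * exp (4 * M * (T - t0)) * h ^ p"
        using nh 1 K h M T by (intro mult_right_mono mult_mono mult_left_mono) auto
      also have "\<dots> \<le> C * h ^ p" unfolding C_def using h by (intro mult_right_mono) auto
      finally show ?thesis .
    qed
    have E_step: "(1 + 4 * (h * M)) * E n + 2 * (K * h ^ Suc p) \<le> E (Suc n)" for n
    proof -
      have "1 \<le> (1 + 4 * (h * M)) ^ Suc n" using h M by (intro one_le_power) auto
      then have "2 * (K * h ^ Suc p) * 1 \<le> 2 * (K * h ^ Suc p) * (1 + 4 * (h * M)) ^ Suc n"
        using K h by (intro mult_left_mono) auto
      then show ?thesis by (simp add: E_def algebra_simps)
    qed
    define step where "step n x y \<longleftrightarrow> y = x + h * \<Phi> (g n, x) (g (Suc n), y) \<and>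
        \<bar>y - u (g (Suc n))\<bar> \<le> \<rho>" for n x y
    have step_ex: "\<exists>y. step n x y \<and> \<bar>y - u (g (Suc n))\<bar> \<le> E (Suc n)"
      if n: "Suc n \<le> N" and x: "\<bar>x - u (g n)\<bar> \<le> E n" for n x
    proof -
      have x4: "\<bar>x - u (g n)\<bar> \<le> \<rho> / 4" using x EC[of n] n hC by simp
      have x1: "\<bar>x - u (g n)\<bar> \<le> \<rho>" using x4 \<rho> by simp
      have "\<exists>y. \<bar>y - u (g (Suc n))\<bar> \<le> \<rho> \<and> y = x + h * \<Phi> (g n, x) (g (Suc n), y)"
      proof (rule implicit_step_exists[where M = M])
        show "\<bar>x + h * \<Phi> (g n, x) (g (Suc n), y) - u (g (Suc n))\<bar> \<le> \<rho>"
          if y: "\<bar>y - u (g (Suc n))\<bar> \<le> \<rho>" for y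
        proof -
          \<comment> \<open>The three terms of \<open>defect\<close> add up to at most \<rho>/4 +
            5\<rho>/16 + \<rho>/4 = 13\<rho>/16.\<close>
          have "h * M * (\<bar>x - u (g n)\<bar> + \<bar>y - u (g (Suc n))\<bar>) \<le> 1/4 * (\<rho>/4 + \<rho>)"
            using hM x4 y h M by (intro mult_mono) auto
          then show ?thesis using defect[OF n x1 y] x4 hK \<rho> by (simp add: field_simps)
        qed
      qed (use n x1 lip_y h M hM \<rho> in auto)
      then obtain y where y: "step n x y" unfolding step_def by blast
      have "\<bar>y - u (g (Suc n))\<bar> \<le> \<bar>x - u (g n)\<bar> + h * M * (\<bar>x - u (g n)\<bar> + \<bar>y - u (g (Suc n))\<bar>) + K * h ^ Suc p"
        using defect[OF n x1, of y] y unfolding step_def by simp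
      from one_step_error[OF this] have "\<bar>y - u (g (Suc n))\<bar> \<le> (1 + 4 * (h * M)) * \<bar>x - u (g n)\<bar> + 2 * (K * h ^ Suc p)"
        using h M hM K by simp
      also have "\<dots> \<le> (1 + 4 * (h * M)) * E n + 2 * (K * h ^ Suc p)"
        using x h M K by (intro add_mono mult_left_mono) auto
      finally show ?thesis using y E_step[of n] by force
    qed
    \<comment> \<open>The clause for \<open>n = 0\<close> pins the start of the chosen sequence. The
      guards let the choice go on arbitrarily beyond \<open>N\<close>, so that \<open>v\<close> is a
      total function.\<close>
    have "\<exists>v. \<forall>n. (n \<le> N \<longrightarrow> \<bar>v n - u (g n)\<bar> \<le> E n \<and> (n = 0 \<longrightarrow> v n = u t0)) \<and>
        (Suc n \<le> N \<longrightarrow> step n (v n) (v (Suc n)))"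
    proof (rule dependent_nat_choice)
      show "\<exists>x. 0 \<le> N \<longrightarrow> \<bar>x - u (g 0)\<bar> \<le> E 0 \<and> (0 = (0::nat) \<longrightarrow> x = u t0)"
        by (rule exI[of _ "u t0"]) (simp add: g0 E_def)
    next
      fix x n
      assume "n \<le> N \<longrightarrow> \<bar>x - u (g n)\<bar> \<le> E n \<and> (n = 0 \<longrightarrow> x = u t0)"
      then show "\<exists>y. (Suc n \<le> N \<longrightarrow> \<bar>y - u (g (Suc n))\<bar> \<le> E (Suc n) \<and> (Suc n = 0 \<longrightarrow> y = u t0)) \<and>
          (Suc n \<le> N \<longrightarrow> step n x y)"
        using step_ex[of n x] by (cases "Suc n \<le> N") auto
    qed
    then obtain v where v: "\<And>n. n \<le> N \<Longrightarrow> \<bar>v n - u (g n)\<bar> \<le> E n" "v 0 = u t0"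
        "\<And>n. Suc n \<le> N \<Longrightarrow> step n (v n) (v (Suc n))" by blast
    have vC: "\<bar>v n - u (g n)\<bar> \<le> C * h ^ p" if "n \<le> N" for n
      using v(1)[OF that] EC[OF that] by simp
    have v_tube: "\<bar>v n - u (g n)\<bar> \<le> \<rho>" if "n \<le> N" for n
      using vC[OF that] hC \<rho> by simp
    have run_iff: "run h w \<longleftrightarrow> w 0 = u t0 \<and> (\<forall>n<N. step n (w n) (w (Suc n)))" for w
    proof
      assume "run h w"
      then show "w 0 = u t0 \<and> (\<forall>n<N. step n (w n) (w (Suc n)))"
        unfolding run_def step_def N_def[symmetric] g_def[symmetric] using tubeD by auto
    next
      assume w: "w 0 = u t0 \<and> (\<forall>n<N. step n (w n) (w (Suc n)))"
      \<comment> \<open>At index 0 the distance to the solution is zero; at every later index the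
        bound is part of \<open>step\<close>.\<close>
      have "\<bar>w n - u (g n)\<bar> \<le> \<rho>" if "n \<le> N" for n
      proof (cases n)
        case 0 then show ?thesis using w g0 \<rho> by simp
      next
        case (Suc m) then show ?thesis using w that by (auto simp: step_def)
      qed
      then show "run h w"
        unfolding run_def N_def[symmetric] g_def[symmetric] using w tubeI
        unfolding step_def by blast
    qed
    have "w n = v n" if w: "run h w" and "n \<le> N" for w n
      using \<open>n \<le> N\<close>
    proof (induction n)
      case 0 then show ?case using w v(2) run_iff by simp
    next
      case (Suc n)
      then have eq: "w n = v n" and n: "Suc n \<le> N" by auto
      have sw: "step n (v n) (w (Suc n))" using w n eq run_iff[of w] by (metis Suc_le_lessD)
      show ?case
        by (rule implicit_step_unique[where \<phi> = "\<lambda>y. \<Phi> (g n, v n) (g (Suc n), y)" and M = M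
              and c = "u (g (Suc n))" and \<rho> = \<rho> and h = h and x = "v n"])
           (use sw v(3)[OF n] lip_y n v_tube h hM in \<open>auto simp: step_def\<close>)
    qed
    then have "\<forall>w. run h w \<longrightarrow> (\<forall>n\<le>num_steps t0 T h. w n = v n)"
      unfolding N_def by blast
    moreover have "run h v" unfolding run_iff using v by auto
    moreover have "\<forall>n\<le>num_steps t0 T h. \<bar>u (grid t0 h n) - v n\<bar> \<le> C * h ^ p"
      using vC unfolding N_def g_def by (metis abs_minus_commute)
    ultimately show ?thesis by blast
  qed
  then show ?thesis using H C by blast
qed

subsection \<open>Scaled means as corrected arithmetic means\<close>

text \<open>The parameter \<open>X\<close> is the squared scale, since the quadratic equation
  determines the square; the correction to the arithmetic mean is explicit.\<close>

definition conic_mean :: "real \<Rightarrow> real \<Rightarrow> real \<Rightarrow> real" where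
  "conic_mean X \<alpha> \<beta> = (\<alpha> + \<beta>) / 2 *
     (1 - (\<alpha> - \<beta>)\<^sup>2 / (sqrt (X + \<alpha>\<^sup>2) + sqrt (X + \<beta>\<^sup>2))\<^sup>2)"

lemma specular_mean_quotient_form:
  assumes "0 < ra" "0 < rb"
  shows "(\<alpha> / ra + \<beta> / rb) * inverse (1 / ra + 1 / rb) = (\<alpha> * rb + \<beta> * ra) / (ra + (rb::real))"
proof -
  have "\<alpha> / ra + \<beta> / rb = (\<alpha> * rb + \<beta> * ra) / (ra * rb)"
    using assms by (simp add: field_simps)
  moreover have "1 / ra + 1 / rb = (ra + rb) / (ra * rb)"
    using assms by (simp add: field_simps)
  ultimately show ?thesis using assms by simp
qed

text \<open>With \<open>ra\<close> and \<open>rb\<close> the two roots, the mean is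
  \<open>(\<alpha> * rb + \<beta> * ra) / (ra + rb)\<close>. Twice its numerator is \<open>(\<alpha>
  + \<beta>) * (ra + rb) + (\<alpha> - \<beta>) * (rb - ra)\<close>, and rationalising
  \<open>rb - ra\<close> produces the quadratic correction.\<close>

lemma scaled_mean_conv_conic_mean:
  assumes X: "0 < X"
  shows "scaled_mean (sqrt X) \<alpha> \<beta> = conic_mean X \<alpha> \<beta>"
proof -
  define s where "s = sqrt X"
  define ra rb where "ra = sqrt (X + \<alpha>\<^sup>2)" and "rb = sqrt (X + \<beta>\<^sup>2)"
  have s: "0 < s" "s\<^sup>2 = X" using X by (auto simp: s_def)
  have ra: "0 < ra" "ra\<^sup>2 = X + \<alpha>\<^sup>2" and rb: "0 < rb" "rb\<^sup>2 = X + \<beta>\<^sup>2"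
    using X by (auto simp: ra_def rb_def add_pos_nonneg)
  have root: "sqrt (1 + (x / s)\<^sup>2) = sqrt (X + x\<^sup>2) / s" for x
  proof -
    have "1 + (x / s)\<^sup>2 = (X + x\<^sup>2) / s\<^sup>2" using s X by (simp add: field_simps)
    then show ?thesis using s(1) by (simp add: real_sqrt_divide)
  qed
  have "scaled_mean s \<alpha> \<beta> = s * ((\<alpha> / ra + \<beta> / rb) * inverse (s * (1 / ra + 1 / rb)))"
    unfolding scaled_mean_def specular_mean_def root ra_def[symmetric] rb_def[symmetric]
    using s(1) by (simp add: algebra_simps)
  also have "\<dots> = (\<alpha> / ra + \<beta> / rb) * inverse (1 / ra + 1 / rb)"
    using s(1) by simp
  also have "\<dots> = (\<alpha> * rb + \<beta> * ra) / (ra + rb)"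
    by (rule specular_mean_quotient_form) fact+
  also have "\<dots> = (\<alpha> + \<beta>) / 2 * (1 - (\<alpha> - \<beta>)\<^sup>2 / (ra + rb)\<^sup>2)"
  proof -
    have "(\<alpha> - \<beta>) * (rb - ra) * (ra + rb) = (\<alpha> - \<beta>) * (rb\<^sup>2 - ra\<^sup>2)"
      by (simp add: power2_eq_square algebra_simps)
    also have "\<dots> = - (\<alpha> + \<beta>) * (\<alpha> - \<beta>)\<^sup>2"
      unfolding ra rb by (simp add: power2_eq_square algebra_simps)
    finally have "(\<alpha> * rb + \<beta> * ra) * (2 * (ra + rb)) = (\<alpha> + \<beta>) * ((ra + rb)\<^sup>2 - (\<alpha> - \<beta>)\<^sup>2)"
      by (simp add: power2_eq_square algebra_simps)
    moreover have "x / s = k / 2 * (1 - d / s\<^sup>2)" if "x * (2 * s) = k * (s\<^sup>2 - d)" "0 < s" for x s k d :: real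
      using that by (simp add: field_simps power2_eq_square)
    ultimately show ?thesis using ra rb by (meson add_pos_pos)
  qed
  finally show ?thesis by (simp add: conic_mean_def s_def ra_def rb_def)
qed

section \<open>Averages of products versus products of averages\<close>

lemma average_of_product:
  fixes x1 x2 y1 y2 :: real
  shows "(x1 * y1 + x2 * y2) / 2 = (x1 + x2) / 2 * ((y1 + y2) / 2) + (x1 - x2) * (y1 - y2) / 4"
  by (simp add: field_simps)

lemma abs_average_le: "\<bar>x\<bar> \<le> k \<Longrightarrow> \<bar>y\<bar> \<le> k \<Longrightarrow> \<bar>(x + y) / 2\<bar> \<le> (k::real)"
  by (simp add: abs_le_iff)

lemma abs_mult_le: "\<bar>x\<bar> \<le> a \<Longrightarrow> \<bar>y\<bar> \<le> b \<Longrightarrow> \<bar>x * y\<bar> \<le> a * (b::real)"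
  by (simp add: abs_mult mult_mono')

text \<open>The gap between the mean of the inverses and the inverse of the mean is quadratic in
  \<open>x - y\<close>.\<close>

lemma average_inverse_diff:
  fixes x y :: real
  assumes "0 < x" "0 < y"
  shows "(inverse x + inverse y) / 2 - 2 / (x + y)
    = (x - y)\<^sup>2 * (inverse x * inverse y * inverse (x + y)) / 2"
proof -
  have "x + y \<noteq> 0" "x \<noteq> 0" "y \<noteq> 0" using assms by auto
  then show ?thesis by (simp add: inverse_eq_divide divide_simps) algebra
qed

text \<open>Kept apart so that linear arithmetic sees the large products as atoms; the coefficients
  leave slack.\<close>

lemma averaging_error_bound:
  fixes x :: real
  assumes "x = e1 + e2 + e3 + e4" "\<bar>e1\<bar> \<le> 2 * B" "\<bar>e2\<bar> \<le> A" "\<bar>e3\<bar> \<le> A" "\<bar>e4\<bar> \<le> C" "0 \<le> B" "0 \<le> C"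
  shows "\<bar>x\<bar> \<le> 2 * A + 4 * B + 2 * C"
  using assms by linarith

text \<open>Telescoping: an average of triple products is turned into a product of three averages by
  replacing one factor at a time.\<close>

lemma product_average_splitting:
  fixes m :: real
  assumes "L = A * V + e" "A = m * B + E" "B = M + D"
  shows "L - m * M * W = e + E * V + m * D * V + m * M * (V - W)"
  unfolding assms by (simp add: algebra_simps)

text \<open>By \<open>average_of_product\<close> and \<open>average_inverse_diff\<close> every averaging error is a product of two
  differences, hence \<open>O(h\<^sup>2)\<close>, and no second derivatives are needed.\<close>
lemma average_cubic_quotient:
  fixes \<alpha> \<beta> P Q ra rb K c h :: real
  assumes c: "0 < c" and K: "0 \<le> K" and h: "0 \<le> h"
    and bnd: "\<bar>\<alpha>\<bar> \<le> K" "\<bar>\<beta>\<bar> \<le> K" "\<bar>P\<bar> \<le> K" "\<bar>Q\<bar> \<le> K"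
    and diff: "\<bar>\<alpha> - \<beta>\<bar> \<le> K * h" "\<bar>P - Q\<bar> \<le> K * h"
    and r: "c \<le> ra" "c \<le> rb" "ra - rb = \<alpha>\<^sup>2 - \<beta>\<^sup>2"
  shows "\<bar>(\<alpha> * Q\<^sup>2 / ra + \<beta> * P\<^sup>2 / rb) / 2 - (\<alpha> + \<beta>) / 2 * ((P + Q) / 2)\<^sup>2 * (2 / (ra + rb))\<bar>
    \<le> (2 * K ^ 3 / c + 4 * K ^ 5 / c ^ 2 + 2 * K ^ 7 / c ^ 3) * h\<^sup>2"
proof -
  have pos: "0 < ra" "0 < rb" using c r by auto
  have "\<bar>(\<alpha> + \<beta>) * (\<alpha> - \<beta>)\<bar> \<le> (2 * K) * (K * h)"
    using bnd diff by (intro abs_mult_le) auto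
  then have dr: "\<bar>ra - rb\<bar> \<le> 2 * K\<^sup>2 * h"
    using r(3) by (simp add: power2_eq_square algebra_simps)
  have "\<bar>(Q + P) * (Q - P)\<bar> \<le> (2 * K) * (K * h)"
    using bnd diff by (intro abs_mult_le) auto
  then have dq: "\<bar>Q\<^sup>2 - P\<^sup>2\<bar> \<le> 2 * K\<^sup>2 * h"
    by (simp add: power2_eq_square algebra_simps)
  have q: "\<bar>Q\<^sup>2\<bar> \<le> K\<^sup>2" "\<bar>P\<^sup>2\<bar> \<le> K\<^sup>2"
    using bnd abs_mult_le[of Q K Q K] abs_mult_le[of P K P K] by (auto simp: power2_eq_square)
  have inv_le: "inverse x \<le> 1 / c" if "c \<le> x" for x
    using that c by (simp add: field_simps)
  have v: "\<bar>inverse ra\<bar> \<le> 1 / c" "\<bar>inverse rb\<bar> \<le> 1 / c"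
    using inv_le r pos by auto
  have dv: "\<bar>inverse ra - inverse rb\<bar> \<le> 2 * K\<^sup>2 * h * (1 / c * (1 / c))"
  proof -
    have "inverse ra - inverse rb = (rb - ra) * (inverse ra * inverse rb)"
      using pos by (simp add: field_simps)
    moreover have "\<bar>(rb - ra) * (inverse ra * inverse rb)\<bar> \<le> 2 * K\<^sup>2 * h * (1 / c * (1 / c))"
      using dr v by (intro abs_mult_le) auto
    ultimately show ?thesis by simp
  qed
  define m where "m = (\<alpha> + \<beta>) / 2"
  have m: "\<bar>m\<bar> \<le> K" using bnd by (auto simp: m_def)
  define V where "V = (inverse ra + inverse rb) / 2"
  have V: "\<bar>V\<bar> \<le> 1 / c" unfolding V_def using v by (rule abs_average_le)
  \<comment> \<open>The four sources of error: \<open>e1\<close> separates the numerators from the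
    inverses, \<open>e2\<close> separates \<alpha> and \<beta> from the squares, \<open>e3\<close>
    replaces the mean square by the square of the mean, and \<open>e4\<close> replaces the mean
    inverse by the inverse mean.\<close>
  define e1 where "e1 = (\<alpha> * Q\<^sup>2 - \<beta> * P\<^sup>2) * (inverse ra - inverse rb) / 4"
  define e2 where "e2 = (\<alpha> - \<beta>) * (Q\<^sup>2 - P\<^sup>2) / 4 * V"
  define e3 where "e3 = m * ((P - Q)\<^sup>2 / 4) * V"
  define e4 where "e4 = m * ((P + Q) / 2)\<^sup>2 * (V - 2 / (ra + rb))"
  have "(\<alpha> * Q\<^sup>2 / ra + \<beta> * P\<^sup>2 / rb) / 2 = (\<alpha> * Q\<^sup>2 + \<beta> * P\<^sup>2) / 2 * V + e1"
    unfolding V_def e1_def divide_inverse[of _ ra] divide_inverse[of _ rb]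
    by (rule average_of_product)
  moreover have "(\<alpha> * Q\<^sup>2 + \<beta> * P\<^sup>2) / 2 = m * ((Q\<^sup>2 + P\<^sup>2) / 2) + (\<alpha> - \<beta>) * (Q\<^sup>2 - P\<^sup>2) / 4"
    unfolding m_def by (rule average_of_product)
  moreover have "(Q\<^sup>2 + P\<^sup>2) / 2 = ((P + Q) / 2)\<^sup>2 + (P - Q)\<^sup>2 / 4"
    by (simp add: field_simps power2_eq_square)
  ultimately have "(\<alpha> * Q\<^sup>2 / ra + \<beta> * P\<^sup>2 / rb) / 2 - m * ((P + Q) / 2)\<^sup>2 * (2 / (ra + rb))
      = e1 + e2 + e3 + e4"
    unfolding e2_def e3_def e4_def by (rule product_average_splitting)
  moreover have "\<bar>e1\<bar> \<le> 2 * (K ^ 5 / c ^ 2 * h\<^sup>2)"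
  proof -
    have "\<alpha> * Q\<^sup>2 - \<beta> * P\<^sup>2 = (\<alpha> - \<beta>) * Q\<^sup>2 + \<beta> * (Q\<^sup>2 - P\<^sup>2)" by (simp add: algebra_simps)
    moreover have "\<bar>(\<alpha> - \<beta>) * Q\<^sup>2\<bar> \<le> K * h * K\<^sup>2" "\<bar>\<beta> * (Q\<^sup>2 - P\<^sup>2)\<bar> \<le> K * (2 * K\<^sup>2 * h)"
      using bnd diff q dq by (intro abs_mult_le; simp)+
    ultimately have "\<bar>\<alpha> * Q\<^sup>2 - \<beta> * P\<^sup>2\<bar> \<le> 3 * K ^ 3 * h"
      by (simp add: power2_eq_square power3_eq_cube algebra_simps)
    from abs_mult_le[OF this dv] have "4 * \<bar>e1\<bar> \<le> 3 * K ^ 3 * h * (2 * K\<^sup>2 * h * (1 / c * (1 / c)))"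
      by (simp add: e1_def)
    also have "\<dots> = 6 * (K ^ 5 / c ^ 2 * h\<^sup>2)"
      using c by (simp add: field_simps eval_nat_numeral)
    also have "\<dots> \<le> 8 * (K ^ 5 / c ^ 2 * h\<^sup>2)"
      using K c h by (intro mult_right_mono) auto
    finally show ?thesis by simp
  qed
  moreover have "\<bar>e2\<bar> \<le> K ^ 3 / c * h\<^sup>2"
  proof -
    have "4 * \<bar>e2\<bar> = \<bar>(\<alpha> - \<beta>) * (Q\<^sup>2 - P\<^sup>2) * V\<bar>"
      by (simp add: e2_def abs_mult)
    also have "\<dots> \<le> K * h * (2 * K\<^sup>2 * h) * (1 / c)"
      by (intro abs_mult_le diff dq V)
    also have "\<dots> = 2 * (K ^ 3 / c * h\<^sup>2)"
      by (simp add: power2_eq_square power3_eq_cube)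
    also have "\<dots> \<le> 4 * (K ^ 3 / c * h\<^sup>2)" using K c h by (intro mult_right_mono) auto
    finally show ?thesis by simp
  qed
  moreover have "\<bar>e3\<bar> \<le> K ^ 3 / c * h\<^sup>2"
  proof -
    have "4 * \<bar>e3\<bar> = \<bar>m * ((P - Q) * (P - Q)) * V\<bar>"
      by (simp add: e3_def power2_eq_square abs_mult)
    also have "\<dots> \<le> K * (K * h * (K * h)) * (1 / c)"
      by (intro abs_mult_le diff m V)
    also have "\<dots> = 1 * (K ^ 3 / c * h\<^sup>2)"
      by (simp add: power2_eq_square power3_eq_cube)
    also have "\<dots> \<le> 4 * (K ^ 3 / c * h\<^sup>2)" using K c h by (intro mult_right_mono) auto
    finally show ?thesis by simp
  qed
  moreover have "\<bar>e4\<bar> \<le> K ^ 7 / c ^ 3 * h\<^sup>2"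
  proof -
    have abs_half: "\<bar>x\<bar> \<le> k" if "x = z / 2" "\<bar>z\<bar> \<le> l" "l = 2 * k" for x z k l :: real
      using that by simp
    have "V - 2 / (ra + rb) = (ra - rb)\<^sup>2 * (inverse ra * inverse rb * inverse (ra + rb)) / 2"
      unfolding V_def using pos by (rule average_inverse_diff)
    moreover have "\<bar>(ra - rb) * (ra - rb) * (inverse ra * inverse rb * inverse (ra + rb))\<bar>
       \<le> 2 * K\<^sup>2 * h * (2 * K\<^sup>2 * h) * (1 / c * (1 / c) * (1 / (2 * c)))"
    proof (intro abs_mult_le dr v)
      show "\<bar>inverse (ra + rb)\<bar> \<le> 1 / (2 * c)"
        using le_imp_inverse_le[of "2 * c" "ra + rb"] r c by (simp add: inverse_eq_divide)
    qed
    moreover have "2 * K\<^sup>2 * h * (2 * K\<^sup>2 * h) * (1 / c * (1 / c) * (1 / (2 * c))) = 2 * (K ^ 4 / c ^ 3 * h\<^sup>2)"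
      by (simp add: power2_eq_square eval_nat_numeral)
    ultimately have "\<bar>V - 2 / (ra + rb)\<bar> \<le> K ^ 4 / c ^ 3 * h\<^sup>2"
      unfolding power2_eq_square[of "ra - rb"] by (rule abs_half)
    then have "\<bar>m * ((P + Q) / 2 * ((P + Q) / 2)) * (V - 2 / (ra + rb))\<bar> \<le> K * (K * K) * (K ^ 4 / c ^ 3 * h\<^sup>2)"
      using m bnd by (intro abs_mult_le) auto
    moreover have "K * (K * K) * (K ^ 4 / c ^ 3 * h\<^sup>2) = K ^ 7 / c ^ 3 * h\<^sup>2"
      by (simp add: eval_nat_numeral)
    ultimately show ?thesis unfolding e4_def power2_eq_square[of "(P + Q) / 2"] by (simp only:)
  qed
  moreover have "0 \<le> K ^ 5 / c ^ 2 * h\<^sup>2" "0 \<le> K ^ 7 / c ^ 3 * h\<^sup>2" using K c h by auto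
  ultimately have "\<bar>(\<alpha> * Q\<^sup>2 / ra + \<beta> * P\<^sup>2 / rb) / 2 - m * ((P + Q) / 2)\<^sup>2 * (2 / (ra + rb))\<bar>
      \<le> 2 * (K ^ 3 / c * h\<^sup>2) + 4 * (K ^ 5 / c ^ 2 * h\<^sup>2) + 2 * (K ^ 7 / c ^ 3 * h\<^sup>2)"
    by (rule averaging_error_bound)
  then show ?thesis unfolding m_def by (simp add: distrib_right)
qed

subsection \<open>The local error\<close>

text \<open>Here \<open>k\<close> is the trapezoidal increment, \<open>z\<close> the exact squared
  difference of slopes and \<open>w\<close> its approximation, \<open>i\<close> and \<open>j\<close>
  are the inverses of the two denominators, and \<open>s\<close> is the trapezoidal
  correction.\<close>

lemma conic_error_splitting:
  fixes q :: real
  assumes "s = q * A" "y = k - h * (m * z * i)" "h * (m * w * j) = q * B"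
  shows "u - v - y = (u - v - k + s) + h * (m * (z - w) * i) + h * (m * w * (i - j)) - q * (A - B)"
  using assms by (simp add: algebra_simps)

text \<open>Again only linear bookkeeping: \<open>A\<close>, \<open>B\<close>, \<open>C\<close>
  stand for the contributions with \<open>K ^ 3\<close>, \<open>K ^ 5\<close>,
  \<open>K ^ 7\<close>.\<close>

lemma conic_error_bound:
  fixes x :: real
  assumes "x = r + e1 + e2 - e3" "\<bar>e1\<bar> \<le> A / 2" "\<bar>e2\<bar> \<le> C / 16" "\<bar>e3\<bar> \<le> A / 2 + B + C / 2"
    "0 \<le> C" "\<bar>r\<bar> \<le> R"
  shows "\<bar>x\<bar> \<le> R + A + B + C"
  using assms by linarith

text \<open>Intended reading: \<beta>, \<open>P\<close>, \<open>a\<close> are the first three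
  derivatives of the solution at \<open>t\<close>, and \<alpha>, \<open>Q\<close>, \<open>d\<close>
  those at \<open>t + h\<close>. By \<open>scale\<close> the leading terms of the trapezoidal defect
  and of the correction in the mean cancel; what remains are replacement errors of relative order
  \<open>h\<^sup>2\<close>.\<close>

lemma conic_mean_truncation:
  fixes \<alpha> \<beta> P Q a d K c h X u\<^sub>0 u\<^sub>1 :: real
  assumes c: "0 < c" "c \<le> X" and K: "0 \<le> K" and h: "0 \<le> h"
    and bnd: "\<bar>\<alpha>\<bar> \<le> K" "\<bar>\<beta>\<bar> \<le> K" "\<bar>P\<bar> \<le> K" "\<bar>Q\<bar> \<le> K"
    and diff: "\<bar>\<alpha> - \<beta>\<bar> \<le> K * h" "\<bar>P - Q\<bar> \<le> K * h"
    and second: "\<bar>\<alpha> - \<beta> - h / 2 * (P + Q)\<bar> \<le> K * h ^ 3"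
    and first: "\<bar>u\<^sub>1 - u\<^sub>0 - h / 2 * (\<alpha> + \<beta>) + h ^ 3 / 24 * (a + d)\<bar> \<le> K * h ^ 5"
    and scale: "a + d = 3 * \<beta> * P\<^sup>2 / (X + \<beta>\<^sup>2) + 3 * \<alpha> * Q\<^sup>2 / (X + \<alpha>\<^sup>2)"
  shows "\<bar>u\<^sub>1 - u\<^sub>0 - h * conic_mean X \<alpha> \<beta>\<bar>
    \<le> (K + K ^ 3 / c + K ^ 5 / c ^ 2 + K ^ 7 / c ^ 3) * h ^ 5"
proof -
  define ra rb where "ra = X + \<alpha>\<^sup>2" and "rb = X + \<beta>\<^sup>2"
  have r: "c \<le> ra" "c \<le> rb" "0 < ra" "0 < rb" "ra - rb = \<alpha>\<^sup>2 - \<beta>\<^sup>2"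
    using c by (auto simp: ra_def rb_def add_increasing2 add_pos_nonneg)
  define S where "S = (sqrt ra + sqrt rb)\<^sup>2"
  have S: "4 * c \<le> S"
  proof -
    have "(2 * sqrt c)\<^sup>2 \<le> S"
      unfolding S_def using c add_mono[OF real_sqrt_le_mono[OF r(1)] real_sqrt_le_mono[OF r(2)]]
      by (intro power_mono) auto
    then show ?thesis using c by simp
  qed
  have inv_S: "\<bar>inverse S\<bar> \<le> 1 / (4 * c)"
    using le_imp_inverse_le[OF S] S c by (simp add: inverse_eq_divide)
  have inv_r: "\<bar>inverse (2 * (ra + rb))\<bar> \<le> 1 / (4 * c)"
    using le_imp_inverse_le[of "4 * c" "2 * (ra + rb)"] r c by (simp add: inverse_eq_divide)
  define m where "m = (\<alpha> + \<beta>) / 2"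
  have m: "\<bar>m\<bar> \<le> K" using bnd by (auto simp: m_def)
  define w where "w = h / 2 * (P + Q)"
  define avg where "avg = (\<alpha> * Q\<^sup>2 / ra + \<beta> * P\<^sup>2 / rb) / 2"
  \<comment> \<open>\<open>e1\<close> replaces the difference of slopes by \<open>w\<close>,
    \<open>e2\<close> replaces the denominator \<open>S\<close> by \<open>2 * (ra + rb)\<close>, and
    \<open>e3\<close> replaces the average of the end point terms by a product of averages.\<close>
  define e1 where "e1 = h * (m * ((\<alpha> - \<beta>)\<^sup>2 - w\<^sup>2) * inverse S)"
  define e2 where "e2 = h * (m * w\<^sup>2 * (inverse S - inverse (2 * (ra + rb))))"
  define e3 where "e3 = h ^ 3 / 4 * (avg - m * ((P + Q) / 2)\<^sup>2 * (2 / (ra + rb)))"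
  have w: "\<bar>w\<bar> \<le> K * h"
  proof -
    have "\<bar>h * ((P + Q) / 2)\<bar> \<le> h * K" using bnd h by (intro abs_mult_le) auto
    then show ?thesis by (simp add: w_def mult.commute)
  qed
  \<comment> \<open>This is the only use of the balance condition: it expresses the third
    derivatives through slopes and second derivatives.\<close>
  have "h ^ 3 / 24 * (a + d) = h ^ 3 / 4 * avg"
  proof -
    have "a + d = 6 * avg" unfolding scale avg_def ra_def rb_def by simp
    then show ?thesis by simp
  qed
  moreover have "h * conic_mean X \<alpha> \<beta> = h / 2 * (\<alpha> + \<beta>) - h * (m * (\<alpha> - \<beta>)\<^sup>2 * inverse S)"
  proof -
    have "conic_mean X \<alpha> \<beta> = m * (1 - (\<alpha> - \<beta>)\<^sup>2 / S)"
      by (simp add: conic_mean_def m_def S_def ra_def rb_def)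
    moreover have "h / 2 * (\<alpha> + \<beta>) = h * m" by (simp add: m_def)
    moreover have "h * y = k - h * (m * z * inverse S)" if "y = m * (1 - z / S)" "k = h * m" for y k z
      unfolding that by (simp add: divide_inverse algebra_simps)
    ultimately show ?thesis by blast
  qed
  moreover have "h * (m * w\<^sup>2 * inverse (2 * (ra + rb))) = h ^ 3 / 4 * (m * ((P + Q) / 2)\<^sup>2 * (2 / (ra + rb)))"
  proof -
    have "w\<^sup>2 = h\<^sup>2 * ((P + Q) / 2)\<^sup>2"
      by (simp add: w_def power_mult_distrib power_divide)
    moreover have "inverse (2 * s) = (2 / s) / 4" for s :: real
      by (simp add: inverse_eq_divide)
    moreover have "h * (m * (h\<^sup>2 * Y) * (W / 4)) = h ^ 3 / 4 * (m * Y * W)" for Y W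
      by (simp add: power2_eq_square power3_eq_cube)
    ultimately show ?thesis by metis
  qed
  ultimately have "u\<^sub>1 - u\<^sub>0 - h * conic_mean X \<alpha> \<beta> =
      (u\<^sub>1 - u\<^sub>0 - h / 2 * (\<alpha> + \<beta>) + h ^ 3 / 24 * (a + d)) + e1 + e2 - e3"
    unfolding e1_def e2_def e3_def by (rule conic_error_splitting)
  moreover have "\<bar>e1\<bar> \<le> K ^ 3 / c * h ^ 5 / 2"
  proof -
    have "\<bar>(\<alpha> - \<beta> - w) * (\<alpha> - \<beta> + w)\<bar> \<le> K * h ^ 3 * (2 * (K * h))"
    proof (rule abs_mult_le)
      show "\<bar>\<alpha> - \<beta> - w\<bar> \<le> K * h ^ 3" using second by (simp add: w_def)
      show "\<bar>\<alpha> - \<beta> + w\<bar> \<le> 2 * (K * h)" using diff w by linarith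
    qed
    then have "\<bar>(\<alpha> - \<beta>)\<^sup>2 - w\<^sup>2\<bar> \<le> K * h ^ 3 * (2 * (K * h))"
      by (simp add: power2_eq_square algebra_simps)
    then have "\<bar>e1\<bar> \<le> h * (K * (K * h ^ 3 * (2 * (K * h))) * (1 / (4 * c)))"
      unfolding e1_def using h by (intro abs_mult_le m inv_S) auto
    also have "\<dots> = K ^ 3 / c * h ^ 5 / 2" by (simp add: eval_nat_numeral mult_ac)
    finally show ?thesis .
  qed
  moreover have "\<bar>e2\<bar> \<le> K ^ 7 / c ^ 3 * h ^ 5 / 16"
  proof -
    have "\<bar>(\<alpha> + \<beta>) * (\<alpha> - \<beta>)\<bar> \<le> (2 * K) * (K * h)"
      using bnd diff by (intro abs_mult_le) auto
    then have dr: "\<bar>ra - rb\<bar> \<le> 2 * K\<^sup>2 * h"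
      using r(5) by (simp add: power2_eq_square algebra_simps)
    \<comment> \<open>The denominators differ by the square of a difference of roots. Multiplying by
      \<open>S\<close> removes the roots and leaves \<open>(ra - rb)\<^sup>2\<close>, which is of
      order \<open>h\<^sup>2\<close>.\<close>
    have "2 * (ra + rb) - S = (sqrt ra - sqrt rb)\<^sup>2"
      using r by (simp add: S_def power2_eq_square algebra_simps)
    moreover have "(sqrt ra - sqrt rb)\<^sup>2 * S = (ra - rb)\<^sup>2"
    proof -
      have "(sqrt ra - sqrt rb) * (sqrt ra + sqrt rb) = ra - rb"
        using r by (simp add: algebra_simps)
      then show ?thesis unfolding S_def power_mult_distrib[symmetric] by simp
    qed
    ultimately have 1: "(2 * (ra + rb) - S) * S = (ra - rb)\<^sup>2" by simp
    have inverse_diff: "inverse x - inverse y = ((y - x) * x) * (inverse x * inverse x * inverse y)"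
      if "0 < x" "0 < y" for x y :: real
      using that by (simp add: field_simps)
    have "S > 0" "2 * (ra + rb) > 0" using S c r by auto
    then have "inverse S - inverse (2 * (ra + rb)) =
        ((2 * (ra + rb) - S) * S) * (inverse S * inverse S * inverse (2 * (ra + rb)))"
      by (rule inverse_diff)
    also have "\<dots> = (ra - rb) * (ra - rb) * (inverse S * inverse S * inverse (2 * (ra + rb)))"
      unfolding 1 by (simp add: power2_eq_square)
    finally have 2: "e2 = h * (m * (w * w) * ((ra - rb) * (ra - rb) * (inverse S * inverse S * inverse (2 * (ra + rb)))))"
      unfolding e2_def power2_eq_square[of w] by (simp only:)
    have "\<bar>e2\<bar> \<le> h * (K * (K * h * (K * h)) * (2 * K\<^sup>2 * h * (2 * K\<^sup>2 * h) * (1 / (4 * c) * (1 / (4 * c)) * (1 / (4 * c)))))"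
      unfolding 2 using h by (intro abs_mult_le m w dr inv_S inv_r) auto
    also have "\<dots> = K ^ 7 / c ^ 3 * h ^ 5 / 16" by (simp add: eval_nat_numeral mult_ac)
    finally show ?thesis .
  qed
  moreover have "\<bar>e3\<bar> \<le> K ^ 3 / c * h ^ 5 / 2 + K ^ 5 / c ^ 2 * h ^ 5 + K ^ 7 / c ^ 3 * h ^ 5 / 2"
  proof -
    have "\<bar>avg - m * ((P + Q) / 2)\<^sup>2 * (2 / (ra + rb))\<bar>
        \<le> (2 * K ^ 3 / c + 4 * K ^ 5 / c ^ 2 + 2 * K ^ 7 / c ^ 3) * h\<^sup>2"
      unfolding avg_def m_def using average_cubic_quotient[OF c(1) K h bnd diff r(1,2,5)] .
    then have "\<bar>e3\<bar> \<le> h ^ 3 / 4 * ((2 * K ^ 3 / c + 4 * K ^ 5 / c ^ 2 + 2 * K ^ 7 / c ^ 3) * h\<^sup>2)"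
      unfolding e3_def using h by (intro abs_mult_le) auto
    also have "\<dots> = K ^ 3 / c * h ^ 5 / 2 + K ^ 5 / c ^ 2 * h ^ 5 + K ^ 7 / c ^ 3 * h ^ 5 / 2"
    proof -
      have "h ^ 3 / 4 * ((2 * x + 4 * y + 2 * z) * h\<^sup>2) = x * h ^ 5 / 2 + y * h ^ 5 + z * h ^ 5 / 2" for x y z :: real
        by (simp add: field_simps eval_nat_numeral)
      from this[of "K ^ 3 / c" "K ^ 5 / c ^ 2" "K ^ 7 / c ^ 3"] show ?thesis by simp
    qed
    finally show ?thesis .
  qed
  moreover have "0 \<le> K ^ 7 / c ^ 3 * h ^ 5" using K c h by simp
  ultimately have "\<bar>u\<^sub>1 - u\<^sub>0 - h * conic_mean X \<alpha> \<beta>\<bar>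
      \<le> K * h ^ 5 + K ^ 3 / c * h ^ 5 + K ^ 5 / c ^ 2 * h ^ 5 + K ^ 7 / c ^ 3 * h ^ 5"
    using first by (intro conic_error_bound)
  then show ?thesis by (simp add: distrib_right)
qed

section \<open>Taylor expansion of the exact solution\<close>

lemma iterated_derivatives_Taylor:
  fixes g :: "nat \<Rightarrow> real \<Rightarrow> real"
  assumes g: "\<And>i x. i < k \<Longrightarrow> x \<in> {a..b} \<Longrightarrow> (g i has_real_derivative g (Suc i) x) (at x within {a..b})"
    and B: "\<And>i x. i \<le> k \<Longrightarrow> x \<in> {a..b} \<Longrightarrow> \<bar>g i x\<bar> \<le> B"
    and n: "j + n < k" and t: "t \<in> {a..b}" "t + h \<in> {a..b}" and h: "0 \<le> h"
  shows "\<bar>g j (t + h) - (\<Sum>i\<le>n. g (j + i) t * h ^ i / fact i)\<bar> \<le> B * h ^ Suc n / fact n"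
  using field_Taylor[of "{a..b}" n "\<lambda>i. g (j + i)" B t "t + h"] assms by auto

text \<open>All values at \<open>t + h\<close> are expanded about \<open>t\<close>. In the first
  estimate the coefficients of \<open>h ^ 3\<close> and \<open>h ^ 4\<close> cancel, as 1/6 - 1/4 +
  1/12 = 0 and 1/24 - 1/12 + 1/24 = 0, so only remainders of order \<open>h ^ 5\<close>
  survive.\<close>

lemma corrected_trapezoid_defect:
  fixes g :: "nat \<Rightarrow> real \<Rightarrow> real"
  assumes g: "\<And>i x. i < 5 \<Longrightarrow> x \<in> {a..b} \<Longrightarrow> (g i has_real_derivative g (Suc i) x) (at x within {a..b})"
    and B: "\<And>i x. i \<le> 5 \<Longrightarrow> x \<in> {a..b} \<Longrightarrow> \<bar>g i x\<bar> \<le> B"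
    and t: "t \<in> {a..b}" "t + h \<in> {a..b}" and h: "0 \<le> h"
  shows "\<bar>g 0 (t + h) - g 0 t - h / 2 * (g 1 (t + h) + g 1 t) + h ^ 3 / 24 * (g 3 t + g 3 (t + h))\<bar>
    \<le> B * h ^ 5"
    and "\<bar>g 1 (t + h) - g 1 t - h / 2 * (g 2 t + g 2 (t + h))\<bar> \<le> B * h ^ 3"
    and "j < 5 \<Longrightarrow> \<bar>g j (t + h) - g j t\<bar> \<le> B * h"
proof -
  have taylor: "\<bar>g j (t + h) - (\<Sum>i\<le>n. g (j + i) t * h ^ i / fact i)\<bar> \<le> B * h ^ Suc n / fact n"
    if "j + n < 5" for j n
    using iterated_derivatives_Taylor[where g = g and k = 5 and B = B] that g B t h by blast
  have B0: "0 \<le> B" using B[of 0 t] t by auto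
  note simps = eval_nat_numeral fact_reduce
  define r0 where "r0 = g 0 (t + h) - (g 0 t + g 1 t * h + g 2 t * h^2 / 2 + g 3 t * h^3 / 6 + g 4 t * h^4 / 24)"
  define r1 where "r1 = g 1 (t + h) - (g 1 t + g 2 t * h + g 3 t * h^2 / 2 + g 4 t * h^3 / 6)"
  \<comment> \<open>Shorter than \<open>r1\<close>, because the second estimate needs only order
    \<open>h ^ 3\<close>.\<close>
  define r1' where "r1' = g 1 (t + h) - (g 1 t + g 2 t * h + g 3 t * h^2 / 2)"
  define r2 where "r2 = g 2 (t + h) - (g 2 t + g 3 t * h)"
  define r3 where "r3 = g 3 (t + h) - (g 3 t + g 4 t * h)"
  have r0: "\<bar>r0\<bar> \<le> B * h ^ 5 / 24" using taylor[of 0 4] by (simp add: r0_def simps)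
  have r1: "\<bar>r1\<bar> \<le> B * h ^ 4 / 6" using taylor[of 1 3] by (simp add: r1_def simps)
  have r1': "\<bar>r1'\<bar> \<le> B * h ^ 3 / 2" using taylor[of 1 2] by (simp add: r1'_def simps)
  have r2: "\<bar>r2\<bar> \<le> B * h ^ 2" using taylor[of 2 1] by (simp add: r2_def simps)
  have r3: "\<bar>r3\<bar> \<le> B * h ^ 2" using taylor[of 3 1] by (simp add: r3_def simps)
  have "g 0 (t + h) - g 0 t - h / 2 * (g 1 (t + h) + g 1 t) + h ^ 3 / 24 * (g 3 t + g 3 (t + h))
      = r0 - h / 2 * r1 + h ^ 3 / 24 * r3"
    unfolding r0_def r1_def r3_def by (simp add: field_simps eval_nat_numeral)
  moreover have "\<bar>h / 2 * r1\<bar> \<le> h / 2 * (B * h ^ 4 / 6)" "\<bar>h ^ 3 / 24 * r3\<bar> \<le> h ^ 3 / 24 * (B * h ^ 2)"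
    using r1 r3 h by (intro abs_mult_le; simp)+
  moreover have "h / 2 * (B * h ^ 4 / 6) = B * h ^ 5 / 12" "h ^ 3 / 24 * (B * h ^ 2) = B * h ^ 5 / 24"
    by (simp_all add: eval_nat_numeral)
  moreover have "0 \<le> B * h ^ 5" using B0 h by simp
  ultimately show "\<bar>g 0 (t + h) - g 0 t - h / 2 * (g 1 (t + h) + g 1 t) + h ^ 3 / 24 * (g 3 t + g 3 (t + h))\<bar>
    \<le> B * h ^ 5" using r0 by linarith
  have "g 1 (t + h) - g 1 t - h / 2 * (g 2 t + g 2 (t + h)) = r1' - h / 2 * r2"
    unfolding r1'_def r2_def by (simp add: field_simps eval_nat_numeral)
  moreover have "\<bar>h / 2 * r2\<bar> \<le> h / 2 * (B * h ^ 2)"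
    using r2 h by (intro abs_mult_le) auto
  moreover have "h / 2 * (B * h ^ 2) = B * h ^ 3 / 2" by (simp add: eval_nat_numeral)
  ultimately show "\<bar>g 1 (t + h) - g 1 t - h / 2 * (g 2 t + g 2 (t + h))\<bar> \<le> B * h ^ 3"
    using r1' by linarith
  show "\<bar>g j (t + h) - g j t\<bar> \<le> B * h" if "j < 5" using taylor[of j 0] that by simp
qed

text \<open>Collects the nested witnesses of \<open>Ck_interval\<close> in one sequence of
  derivatives; in the induction \<open>case_nat u g\<close> puts \<open>u\<close> in front.\<close>

lemma Ck_interval_derivatives:
  assumes "Ck_interval k u a b"
  shows "\<exists>g. g 0 = u \<and> (\<forall>i<k. \<forall>x\<in>{a..b}. (g i has_real_derivative g (Suc i) x) (at x within {a..b})) \<and>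
    (\<forall>i\<le>k. continuous_on {a..b} (g i))"
  using assms
proof (induction k arbitrary: u)
  case 0
  then show ?case by (intro exI[of _ "\<lambda>_. u"]) simp
next
  case (Suc k)
  then obtain u' where u': "\<And>t. t \<in> {a..b} \<Longrightarrow> (u has_real_derivative u' t) (at t within {a..b})"
    "Ck_interval k u' a b" unfolding Ck_interval.simps by blast
  from Suc.IH[OF u'(2)] obtain g where g: "g 0 = u'"
    "\<And>i x. i < k \<Longrightarrow> x \<in> {a..b} \<Longrightarrow> (g i has_real_derivative g (Suc i) x) (at x within {a..b})"
    "\<And>i. i \<le> k \<Longrightarrow> continuous_on {a..b} (g i)" by blast
  have "continuous_on {a..b} u"
    using u'(1) by (intro DERIV_continuous_on)
  then show ?case
    using u' g by (intro exI[of _ "case_nat u g"]) (auto split: nat.split)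
qed

lemma continuous_functions_uniform_bound:
  fixes f :: "nat \<Rightarrow> 'a::topological_space \<Rightarrow> real"
  assumes "compact S" "\<And>i. i \<le> k \<Longrightarrow> continuous_on S (f i)"
  shows "\<exists>B. \<forall>i\<le>k. \<forall>x\<in>S. \<bar>f i x\<bar> \<le> B"
proof -
  have "bounded (\<Union>i\<in>{..k}. f i ` S)"
    using assms by (intro bounded_UN compact_imp_bounded compact_continuous_image ballI) auto
  then obtain B where "\<forall>y\<in>(\<Union>i\<in>{..k}. f i ` S). norm y \<le> B" by (auto simp: bounded_iff)
  then show ?thesis by auto
qed

subsection \<open>Functions with continuous partial derivatives\<close>

text \<open>Partial derivatives are derivatives along slices, so equality on an open set must become
  local equality along each slice.\<close>

lemma eventually_eq_on_slices:
  fixes f g :: "real \<times> real \<Rightarrow> real"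
  assumes S: "open S" "p \<in> S" and eq: "\<And>q. q \<in> S \<Longrightarrow> f q = g q"
  shows "\<forall>\<^sub>F t in nhds (fst p). f (t, snd p) = g (t, snd p)"
    and "\<forall>\<^sub>F x in nhds (snd p). f (fst p, x) = g (fst p, x)"
proof -
  have "\<forall>\<^sub>F t in nhds (fst p). (t, snd p) \<in> S"
  proof -
    have "((\<lambda>t. (t, snd p)) \<longlongrightarrow> (fst p, snd p)) (nhds (fst p))"
      by (intro tendsto_Pair tendsto_const filterlim_ident)
    from topological_tendstoD[OF this S(1)] show ?thesis using S(2) by simp
  qed
  then show "\<forall>\<^sub>F t in nhds (fst p). f (t, snd p) = g (t, snd p)"
    by eventually_elim (use eq in auto)
  have "\<forall>\<^sub>F x in nhds (snd p). (fst p, x) \<in> S"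
  proof -
    have "((\<lambda>x. (fst p, x)) \<longlongrightarrow> (fst p, snd p)) (nhds (snd p))"
      by (intro tendsto_Pair tendsto_const filterlim_ident)
    from topological_tendstoD[OF this S(1)] show ?thesis using S(2) by simp
  qed
  then show "\<forall>\<^sub>F x in nhds (snd p). f (fst p, x) = g (fst p, x)"
    by eventually_elim (use eq in auto)
qed

text \<open>The recursion in \<open>Ck_plane\<close> mentions \<open>partial_t\<close> and
  \<open>partial_x\<close> as total functions, while calculus rules identify them only on
  \<open>S\<close>; this lemma bridges the gap.\<close>

lemma Ck_plane_cong:
  assumes "open S" "\<And>p. p \<in> S \<Longrightarrow> f p = g p" "Ck_plane k f S"
  shows "Ck_plane k g S"
  using assms(2,3)
proof (induction k arbitrary: f g)
  case 0
  then show ?case using continuous_on_cong[of S S f g] by simp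
next
  case (Suc k)
  note slice = eventually_eq_on_slices[where f = f and g = g, OF assms(1) _ Suc.prems(1)]
  have dt: "partial_t f p = partial_t g p" and dx: "partial_x f p = partial_x g p" if "p \<in> S" for p
    unfolding partial_t_def partial_x_def using slice[OF that] by (auto intro: deriv_cong_ev)
  have "(\<lambda>t. g (t, snd p)) differentiable (at (fst p)) \<and> (\<lambda>x. g (fst p, x)) differentiable (at (snd p))"
    if "p \<in> S" for p
  proof -
    have "(\<lambda>t. f (t, snd p)) differentiable (at (fst p))" "(\<lambda>x. f (fst p, x)) differentiable (at (snd p))"
      using Suc.prems(2) that by auto
    then obtain a b where "((\<lambda>t. f (t, snd p)) has_field_derivative a) (at (fst p))"
      "((\<lambda>x. f (fst p, x)) has_field_derivative b) (at (snd p))"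
      by (auto simp: real_differentiable_def)
    then have "((\<lambda>t. g (t, snd p)) has_field_derivative a) (at (fst p))"
      "((\<lambda>x. g (fst p, x)) has_field_derivative b) (at (snd p))"
      using DERIV_cong_ev[OF refl slice(1)[OF that] refl] DERIV_cong_ev[OF refl slice(2)[OF that] refl] by auto
    then show ?thesis by (auto simp: real_differentiable_def)
  qed
  moreover have "continuous_on S g"
    using Suc.prems continuous_on_cong[of S S f g] by simp
  moreover have "Ck_plane k (partial_t g) S" "Ck_plane k (partial_x g) S"
    using Suc.IH[OF dt] Suc.IH[OF dx] Suc.prems(2) by auto
  ultimately show ?case by simp
qed

lemma Ck_plane_pred: "Ck_plane (Suc k) f S \<Longrightarrow> Ck_plane k f S"
proof (induction k arbitrary: f)
  case (Suc k)
  then show ?case using Ck_plane.simps(2)[of "Suc k" f S] Ck_plane.simps(2)[of k f S] by blast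
qed simp

lemma Ck_plane_mono: "Ck_plane k f S \<Longrightarrow> j \<le> k \<Longrightarrow> Ck_plane j f S"
  by (induction k) (auto simp: le_Suc_eq dest: Ck_plane_pred simp del: Ck_plane.simps)

lemma Ck_plane_continuous: "Ck_plane k f S \<Longrightarrow> continuous_on S f"
  by (cases k) auto

lemma Ck_plane_partials:
  assumes "Ck_plane (Suc k) f S" "p \<in> S"
  shows "((\<lambda>t. f (t, snd p)) has_real_derivative partial_t f p) (at (fst p))"
    and "((\<lambda>x. f (fst p, x)) has_real_derivative partial_x f p) (at (snd p))"
  using assms unfolding partial_t_def partial_x_def
  by (auto simp: DERIV_deriv_iff_real_differentiable)

lemma Ck_plane_SucI:
  assumes S: "open S" and f: "continuous_on S f"
    and t: "\<And>p. p \<in> S \<Longrightarrow> ((\<lambda>t. f (t, snd p)) has_real_derivative ft p) (at (fst p))"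
    and x: "\<And>p. p \<in> S \<Longrightarrow> ((\<lambda>x. f (fst p, x)) has_real_derivative fx p) (at (snd p))"
    and Ck: "Ck_plane k ft S" "Ck_plane k fx S"
  shows "Ck_plane (Suc k) f S"
proof -
  have "ft p = partial_t f p" "fx p = partial_x f p" if "p \<in> S" for p
    unfolding partial_t_def partial_x_def using t[OF that] x[OF that] by (auto simp: DERIV_imp_deriv)
  moreover have "(\<lambda>t. f (t, snd p)) differentiable (at (fst p)) \<and> (\<lambda>x. f (fst p, x)) differentiable (at (snd p))"
    if "p \<in> S" for p
    using t[OF that] x[OF that] unfolding real_differentiable_def by blast
  ultimately show ?thesis
    using f Ck_plane_cong[OF S _ Ck(1), of "partial_t f"] Ck_plane_cong[OF S _ Ck(2), of "partial_x f"] by simp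
qed

lemma Ck_plane_add:
  assumes "open S"
  shows "Ck_plane k f S \<Longrightarrow> Ck_plane k g S \<Longrightarrow> Ck_plane k (\<lambda>p. f p + g p) S"
proof (induction k arbitrary: f g)
  case 0
  then show ?case by (simp add: continuous_on_add)
next
  case (Suc k)
  show ?case
  proof (rule Ck_plane_SucI[OF assms])
    show "continuous_on S (\<lambda>p. f p + g p)"
      using Suc.prems by (intro continuous_on_add Ck_plane_continuous)
    show "((\<lambda>t. f (t, snd p) + g (t, snd p)) has_real_derivative partial_t f p + partial_t g p) (at (fst p))"
      and "((\<lambda>x. f (fst p, x) + g (fst p, x)) has_real_derivative partial_x f p + partial_x g p) (at (snd p))"
      if "p \<in> S" for p
      using DERIV_add[OF Ck_plane_partials(1)[OF Suc.prems(1) that] Ck_plane_partials(1)[OF Suc.prems(2) that]]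
        DERIV_add[OF Ck_plane_partials(2)[OF Suc.prems(1) that] Ck_plane_partials(2)[OF Suc.prems(2) that]]
      by simp_all
  qed (use Suc in auto)
qed

lemma Ck_plane_mult:
  assumes "open S"
  shows "Ck_plane k f S \<Longrightarrow> Ck_plane k g S \<Longrightarrow> Ck_plane k (\<lambda>p. f p * g p) S"
proof (induction k arbitrary: f g)
  case 0
  then show ?case by (simp add: continuous_on_mult)
next
  case (Suc k)
  \<comment> \<open>The product rule pairs partial derivatives with the undifferentiated factors,
    which must be lowered to order \<open>k\<close> for the induction hypothesis.\<close>
  note pred = Suc.prems[THEN Ck_plane_pred]
  show ?case
  proof (rule Ck_plane_SucI[OF assms])
    show "continuous_on S (\<lambda>p. f p * g p)"
      using Suc.prems by (intro continuous_on_mult Ck_plane_continuous)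
    show "((\<lambda>t. f (t, snd p) * g (t, snd p)) has_real_derivative
        partial_t f p * g p + partial_t g p * f p) (at (fst p))"
      and "((\<lambda>x. f (fst p, x) * g (fst p, x)) has_real_derivative
        partial_x f p * g p + partial_x g p * f p) (at (snd p))"
      if "p \<in> S" for p
      using DERIV_mult[OF Ck_plane_partials(1)[OF Suc.prems(1) that] Ck_plane_partials(1)[OF Suc.prems(2) that]]
        DERIV_mult[OF Ck_plane_partials(2)[OF Suc.prems(1) that] Ck_plane_partials(2)[OF Suc.prems(2) that]]
      by simp_all
    show "Ck_plane k (\<lambda>p. partial_t f p * g p + partial_t g p * f p) S"
      "Ck_plane k (\<lambda>p. partial_x f p * g p + partial_x g p * f p) S"
      using Suc.prems pred by (intro Ck_plane_add[OF assms] Suc.IH; simp)+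
  qed
qed

lemma Ck_plane_Lie:
  assumes "open S" "Ck_plane k F S" "Ck_plane (Suc k) G S"
  shows "Ck_plane k (Lie F G) S"
proof -
  have "Lie F G = (\<lambda>p. partial_t G p + F p * partial_x G p)"
    by (auto simp: Lie_def)
  then show ?thesis
    using assms by (auto intro!: Ck_plane_add Ck_plane_mult)
qed

text \<open>Continuous partial derivatives imply total differentiability, which the chain rule along
  a curve requires.\<close>

lemma Ck_plane_has_derivative:
  assumes S: "open S" and G: "Ck_plane 1 G S" and p: "p \<in> S"
  shows "(G has_derivative (\<lambda>v. partial_t G p * fst v + partial_x G p * snd v)) (at p)"
proof -
  obtain t x where [simp]: "p = (t, x)" by (cases p)
  have G': "Ck_plane (Suc 0) G S" using G by simp
  obtain X Y where XY: "open X" "open Y" "(t, x) \<in> X \<times> Y" "X \<times> Y \<subseteq> S"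
    using open_prod_elim[OF S p] \<open>p = (t, x)\<close> by metis
  from XY(3) have tx: "t \<in> X" "x \<in> Y" by auto
  \<comment> \<open>\<open>has_derivative_partialsI\<close> asks for a rectangle whose second factor
    is convex, so \<open>Y\<close> is shrunk to a ball.\<close>
  then obtain e where e: "0 < e" "ball x e \<subseteq> Y" using XY tx by (meson openE)
  let ?Y = "ball x e"
  have sub: "X \<times> ?Y \<subseteq> S" using XY e by auto
  have opn: "open (X \<times> ?Y)" and mem: "(t, x) \<in> X \<times> ?Y" using XY tx e by (auto intro: open_Times)
  have "((\<lambda>(t, x). G (t, x)) has_derivative
      (\<lambda>(dt, dx). partial_t G p * dt + blinfun_apply (blinfun_scaleR_left (partial_x G (t, x))) dx))
      (at (t, x) within X \<times> ?Y)"
  proof (rule has_derivative_partialsI[where fy = "\<lambda>t x. blinfun_scaleR_left (partial_x G (t, x))"])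
    show "((\<lambda>t. G (t, x)) has_derivative (*) (partial_t G p)) (at t within X)"
      using Ck_plane_partials(1)[OF G' p] by (auto simp: has_field_derivative_def has_derivative_at_withinI)
    show "((\<lambda>y. G (s, y)) has_derivative blinfun_apply (blinfun_scaleR_left (partial_x G (s, y)))) (at y within ?Y)"
      if "s \<in> X" "y \<in> ?Y" for s y
    proof -
      have "(s, y) \<in> S" using that sub by auto
      from Ck_plane_partials(2)[OF G' this] show ?thesis
        by (simp add: has_field_derivative_def has_derivative_at_withinI mult_commute_abs)
    qed
    have "continuous_on S (partial_x G)" using G' by simp
    then have "continuous (at p) (partial_x G)" using S p continuous_on_eq_continuous_at by blast
    then have "continuous (at p) (\<lambda>q. blinfun_scaleR_left (partial_x G q))"
      by (rule bounded_linear.continuous[OF bounded_linear_blinfun_scaleR_left])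
    then show "continuous (at (t, x) within X \<times> ?Y) (\<lambda>(s, y). blinfun_scaleR_left (partial_x G (s, y)))"
      by (simp add: case_prod_beta' continuous_at_imp_continuous_at_within)
  qed (use e tx in auto)
  then have "(G has_derivative (\<lambda>v. partial_t G p * fst v + partial_x G p * snd v)) (at (t, x) within X \<times> ?Y)"
    by (simp add: case_prod_beta' mult.commute)
  then show ?thesis using at_within_open[OF mem opn] by simp
qed

text \<open>Chain rule for the curve \<open>(t, u t)\<close>, whose velocity is
  \<open>(1, F (t, u t))\<close>. Working within \<open>I\<close> covers one-sided derivatives at
  end points.\<close>

lemma derivative_along_curve:
  assumes S: "open S" and G: "Ck_plane 1 G S" and mem: "(t, u t) \<in> S"
    and u: "(u has_real_derivative F (t, u t)) (at t within I)"
  shows "((\<lambda>t. G (t, u t)) has_real_derivative Lie F G (t, u t)) (at t within I)"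
proof -
  have "((\<lambda>t. (t, u t)) has_derivative (\<lambda>s. (s, F (t, u t) * s))) (at t within I)"
    using u by (auto simp: has_field_derivative_def intro!: derivative_eq_intros)
  from has_derivative_compose[OF this Ck_plane_has_derivative[OF S G mem]]
  have "((\<lambda>t. G (t, u t)) has_derivative
      (\<lambda>s. partial_t G (t, u t) * s + partial_x G (t, u t) * (F (t, u t) * s))) (at t within I)"
    by simp
  moreover have "(\<lambda>s. partial_t G (t, u t) * s + partial_x G (t, u t) * (F (t, u t) * s))
      = (*) (Lie F G (t, u t))"
    by (simp add: fun_eq_iff Lie_def algebra_simps)
  ultimately show ?thesis by (simp only: has_field_derivative_def)
qed

text \<open>Each fibre of the tube is an interval, so the mean value inequality applies with a bound
  of \<open>partial_x G\<close> on the compact tube. This serves \<open>F\<close> as well as its Lie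
  derivatives.\<close>

lemma Ck_plane_Lipschitz_in_x:
  assumes S: "open S" and G: "Ck_plane 1 G S" and K: "compact (tube t0 T \<rho> u)" "tube t0 T \<rho> u \<subseteq> S"
  shows "\<exists>L. \<forall>t x y. (t, x) \<in> tube t0 T \<rho> u \<longrightarrow> (t, y) \<in> tube t0 T \<rho> u \<longrightarrow>
    \<bar>G (t, x) - G (t, y)\<bar> \<le> L * \<bar>x - y\<bar>"
proof -
  have G': "Ck_plane (Suc 0) G S" using G by simp
  have "continuous_on (tube t0 T \<rho> u) (partial_x G)"
    using G' K by (auto intro: continuous_on_subset)
  from compact_imp_bounded[OF compact_continuous_image[OF this K(1)]]
  obtain L where L: "\<And>p. p \<in> tube t0 T \<rho> u \<Longrightarrow> \<bar>partial_x G p\<bar> \<le> L"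
    by (auto simp: bounded_iff)
  have "\<bar>G (t, x) - G (t, y)\<bar> \<le> L * \<bar>x - y\<bar>"
    if "(t, x) \<in> tube t0 T \<rho> u" "(t, y) \<in> tube t0 T \<rho> u" for t x y
  proof -
    let ?I = "{u t - \<rho>..u t + \<rho>}"
    have t: "t \<in> {t0..T}" and xy: "x \<in> ?I" "y \<in> ?I" using that by (auto simp: tube_def)
    have I: "(t, z) \<in> tube t0 T \<rho> u" if "z \<in> ?I" for z using t that by (auto simp: tube_def)
    have "norm (G (t, x) - G (t, y)) \<le> L * norm (x - y)"
    proof (rule field_differentiable_bound[where S = ?I and f' = "\<lambda>z. partial_x G (t, z)"])
      show "((\<lambda>x. G (t, x)) has_real_derivative partial_x G (t, z)) (at z within ?I)" if "z \<in> ?I" for z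
        using Ck_plane_partials(2)[OF G', of "(t, z)"] I[OF that] K(2)
        by (auto intro: has_field_derivative_at_within)
      show "norm (partial_x G (t, z)) \<le> L" if "z \<in> ?I" for z using L[OF I[OF that]] by simp
    qed (use xy in auto)
    then show ?thesis by simp
  qed
  then show ?thesis by blast
qed

subsection \<open>Lipschitz bounds and the adaptive scale\<close>

text \<open>The relation \<open>R\<close> selects the pairs of points that are compared: the iteration only needs
  Lipschitz bounds between points with the same time coordinates.\<close>
locale separation =
  fixes R :: "'a \<Rightarrow> 'a \<Rightarrow> bool" and d :: "'a \<Rightarrow> 'a \<Rightarrow> real"
  assumes d_nonneg: "R z w \<Longrightarrow> 0 \<le> d z w"
begin

text \<open>Boundedness is included because products of Lipschitz functions need it. Both arguments
  are bounded explicitly, since \<open>R\<close> is not assumed symmetric.\<close>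

definition lip_bdd :: "('a \<Rightarrow> real) \<Rightarrow> bool" where
  "lip_bdd g \<longleftrightarrow> (\<exists>K\<ge>0. \<forall>z w. R z w \<longrightarrow> \<bar>g z\<bar> \<le> K \<and> \<bar>g w\<bar> \<le> K \<and> \<bar>g z - g w\<bar> \<le> K * d z w)"

lemma lip_bddE:
  assumes "lip_bdd g"
  obtains K where "0 \<le> K" "\<And>z w. R z w \<Longrightarrow> \<bar>g z\<bar> \<le> K" "\<And>z w. R z w \<Longrightarrow> \<bar>g w\<bar> \<le> K"
    "\<And>z w. R z w \<Longrightarrow> \<bar>g z - g w\<bar> \<le> K * d z w"
  using assms unfolding lip_bdd_def by blast

lemma lip_bddI:
  assumes b: "\<And>z w. R z w \<Longrightarrow> \<bar>g z\<bar> \<le> B" "\<And>z w. R z w \<Longrightarrow> \<bar>g w\<bar> \<le> B"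
    and L: "\<And>z w. R z w \<Longrightarrow> \<bar>g z - g w\<bar> \<le> L * d z w"
  shows "lip_bdd g"
  unfolding lip_bdd_def
proof (intro exI[of _ "max 0 (max B L)"] conjI allI impI)
  fix z w assume R: "R z w"
  show "\<bar>g z\<bar> \<le> max 0 (max B L)" "\<bar>g w\<bar> \<le> max 0 (max B L)" using b[OF R] by auto
  have "L * d z w \<le> max 0 (max B L) * d z w" using d_nonneg[OF R] by (intro mult_right_mono) auto
  then show "\<bar>g z - g w\<bar> \<le> max 0 (max B L) * d z w" using L[OF R] by simp
qed simp

lemma lip_bdd_cong:
  assumes "lip_bdd f" "\<And>z w. R z w \<Longrightarrow> f z = g z" "\<And>z w. R z w \<Longrightarrow> f w = g w"
  shows "lip_bdd g"
  using assms unfolding lip_bdd_def by metis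

lemma lip_bdd_const: "lip_bdd (\<lambda>_. k)"
  by (rule lip_bddI[where B = "\<bar>k\<bar>" and L = 0]) auto

lemma lip_bdd_add:
  assumes "lip_bdd f" "lip_bdd g" shows "lip_bdd (\<lambda>z. f z + g z)"
proof -
  obtain K where K: "0 \<le> K" "\<And>z w. R z w \<Longrightarrow> \<bar>f z\<bar> \<le> K" "\<And>z w. R z w \<Longrightarrow> \<bar>f w\<bar> \<le> K"
    "\<And>z w. R z w \<Longrightarrow> \<bar>f z - f w\<bar> \<le> K * d z w" using lip_bddE[OF assms(1)] by blast
  obtain M where M: "0 \<le> M" "\<And>z w. R z w \<Longrightarrow> \<bar>g z\<bar> \<le> M" "\<And>z w. R z w \<Longrightarrow> \<bar>g w\<bar> \<le> M"
    "\<And>z w. R z w \<Longrightarrow> \<bar>g z - g w\<bar> \<le> M * d z w" using lip_bddE[OF assms(2)] by blast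
  show ?thesis
  proof (rule lip_bddI[where B = "K + M" and L = "K + M"])
    fix z w assume R: "R z w"
    show "\<bar>f z + g z\<bar> \<le> K + M" "\<bar>f w + g w\<bar> \<le> K + M"
      using K(2,3)[OF R] M(2,3)[OF R] by linarith+
    show "\<bar>f z + g z - (f w + g w)\<bar> \<le> (K + M) * d z w"
      using K(4)[OF R] M(4)[OF R] unfolding distrib_right by linarith
  qed
qed

lemma lip_bdd_mult:
  assumes "lip_bdd f" "lip_bdd g" shows "lip_bdd (\<lambda>z. f z * g z)"
proof -
  obtain K where K: "0 \<le> K" "\<And>z w. R z w \<Longrightarrow> \<bar>f z\<bar> \<le> K" "\<And>z w. R z w \<Longrightarrow> \<bar>f w\<bar> \<le> K"
    "\<And>z w. R z w \<Longrightarrow> \<bar>f z - f w\<bar> \<le> K * d z w" using lip_bddE[OF assms(1)] by blast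
  obtain M where M: "0 \<le> M" "\<And>z w. R z w \<Longrightarrow> \<bar>g z\<bar> \<le> M" "\<And>z w. R z w \<Longrightarrow> \<bar>g w\<bar> \<le> M"
    "\<And>z w. R z w \<Longrightarrow> \<bar>g z - g w\<bar> \<le> M * d z w" using lip_bddE[OF assms(2)] by blast
  show ?thesis
  proof (rule lip_bddI[where B = "K * M" and L = "2 * K * M"])
    fix z w assume R: "R z w"
    show "\<bar>f z * g z\<bar> \<le> K * M" "\<bar>f w * g w\<bar> \<le> K * M"
      using K(1,2,3) M(1,2,3) R by (auto simp: abs_mult intro!: mult_mono)
    have "f z * g z - f w * g w = (f z - f w) * g z + f w * (g z - g w)"
      by (simp add: algebra_simps)
    also have "\<bar>\<dots>\<bar> \<le> \<bar>f z - f w\<bar> * \<bar>g z\<bar> + \<bar>f w\<bar> * \<bar>g z - g w\<bar>"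
      by (metis abs_mult abs_triangle_ineq)
    also have "\<dots> \<le> (K * d z w) * M + K * (M * d z w)"
      using K M R d_nonneg[OF R] by (intro add_mono mult_mono) auto
    finally show "\<bar>f z * g z - f w * g w\<bar> \<le> 2 * K * M * d z w" by (simp add: algebra_simps)
  qed
qed

lemma lip_bdd_diff:
  assumes "lip_bdd f" "lip_bdd g" shows "lip_bdd (\<lambda>z. f z - g z)"
  using lip_bdd_add[OF assms(1) lip_bdd_mult[OF lip_bdd_const[of "-1"] assms(2)]] by simp

lemma lip_bdd_power2: "lip_bdd f \<Longrightarrow> lip_bdd (\<lambda>z. (f z)\<^sup>2)"
  unfolding power2_eq_square by (rule lip_bdd_mult)

lemma lip_bdd_abs:
  assumes "lip_bdd f" shows "lip_bdd (\<lambda>z. \<bar>f z\<bar>)"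
proof -
  obtain K where K: "0 \<le> K" "\<And>z w. R z w \<Longrightarrow> \<bar>f z\<bar> \<le> K" "\<And>z w. R z w \<Longrightarrow> \<bar>f w\<bar> \<le> K"
    "\<And>z w. R z w \<Longrightarrow> \<bar>f z - f w\<bar> \<le> K * d z w" using lip_bddE[OF assms(1)] by blast
  show ?thesis
    by (rule lip_bddI[where B = K and L = K]) (use K in \<open>auto intro: order_trans[OF abs_triangle_ineq3]\<close>)
qed

lemma lip_bdd_inverse:
  assumes "lip_bdd f" and c: "0 < c" "\<And>z w. R z w \<Longrightarrow> c \<le> \<bar>f z\<bar>" "\<And>z w. R z w \<Longrightarrow> c \<le> \<bar>f w\<bar>"
  shows "lip_bdd (\<lambda>z. inverse (f z))"
proof -
  obtain K where K: "0 \<le> K" "\<And>z w. R z w \<Longrightarrow> \<bar>f z - f w\<bar> \<le> K * d z w"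
    using lip_bddE[OF assms(1)] by metis
  have inv: "\<bar>inverse x\<bar> \<le> inverse c" if "c \<le> \<bar>x\<bar>" for x
    using that c(1) by (simp add: le_imp_inverse_le)
  show ?thesis
  proof (rule lip_bddI[where B = "inverse c" and L = "K * (inverse c * inverse c)"])
    fix z w assume R: "R z w"
    note cz = c(2)[OF R] and cw = c(3)[OF R]
    show "\<bar>inverse (f z)\<bar> \<le> inverse c" "\<bar>inverse (f w)\<bar> \<le> inverse c"
      using inv cz cw by auto
    have "f z \<noteq> 0" "f w \<noteq> 0" using c(1) cz cw by auto
    then have "\<bar>inverse (f z) - inverse (f w)\<bar> = \<bar>f z - f w\<bar> * (\<bar>inverse (f z)\<bar> * \<bar>inverse (f w)\<bar>)"
      by (simp add: inverse_diff_inverse abs_mult abs_minus_commute mult_ac)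
    also have "\<dots> \<le> (K * d z w) * (inverse c * inverse c)"
      using K R inv[OF cz] inv[OF cw] c(1) d_nonneg[OF R] by (intro mult_mono) auto
    finally show "\<bar>inverse (f z) - inverse (f w)\<bar> \<le> K * (inverse c * inverse c) * d z w"
      by (simp add: mult_ac)
  qed
qed

text \<open>Rationalising divides the difference of the radicands by a sum of roots, which is at
  least \<open>sqrt c\<close>.\<close>

lemma lip_bdd_sqrt:
  assumes "lip_bdd f" and c: "0 < c" "\<And>z w. R z w \<Longrightarrow> c \<le> f z" "\<And>z w. R z w \<Longrightarrow> c \<le> f w"
  shows "lip_bdd (\<lambda>z. sqrt (f z))"
proof -
  obtain K where K: "0 \<le> K" "\<And>z w. R z w \<Longrightarrow> \<bar>f z\<bar> \<le> K" "\<And>z w. R z w \<Longrightarrow> \<bar>f w\<bar> \<le> K"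
    "\<And>z w. R z w \<Longrightarrow> \<bar>f z - f w\<bar> \<le> K * d z w" using lip_bddE[OF assms(1)] by blast
  show ?thesis
  proof (rule lip_bddI[where B = "sqrt K" and L = "K / sqrt c"])
    fix z w assume R: "R z w"
    note cz = c(2)[OF R] and cw = c(3)[OF R]
    show "\<bar>sqrt (f z)\<bar> \<le> sqrt K" "\<bar>sqrt (f w)\<bar> \<le> sqrt K"
      using K(2,3)[OF R] c(1) cz cw by auto
    have pos: "0 < f z" "0 < f w" using c(1) cz cw by auto
    have "(sqrt (f z) - sqrt (f w)) * (sqrt (f z) + sqrt (f w)) = f z - f w"
      using pos by (simp add: algebra_simps)
    then have "\<bar>sqrt (f z) - sqrt (f w)\<bar> * (sqrt (f z) + sqrt (f w)) = \<bar>f z - f w\<bar>"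
      using pos by (metis abs_mult abs_of_pos add_pos_pos real_sqrt_gt_zero)
    moreover have "\<bar>sqrt (f z) - sqrt (f w)\<bar> * sqrt c
        \<le> \<bar>sqrt (f z) - sqrt (f w)\<bar> * (sqrt (f z) + sqrt (f w))"
      using cz pos by (intro mult_left_mono) (auto simp: add_increasing2)
    ultimately have "\<bar>sqrt (f z) - sqrt (f w)\<bar> * sqrt c \<le> K * d z w"
      using K(4)[OF R] by linarith
    then show "\<bar>sqrt (f z) - sqrt (f w)\<bar> \<le> K / sqrt c * d z w"
      using c(1) by (simp add: field_simps)
  qed
qed

end

text \<open>The radicand of \<open>Sigma_scale\<close>; positivity, balance and regularity are all
  proved for it rather than for its root.\<close>

definition scale_sq :: "(real \<times> real \<Rightarrow> real) \<Rightarrow> real \<times> real \<Rightarrow> real \<times> real \<Rightarrow> real" where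
  "scale_sq F p q =
     (- coeff_B F p q + sgn (coeff_A F p q) * sqrt (coeff_D F p q)) / (2 * coeff_A F p q)"

lemma Sigma_scale_eq: "Sigma_scale F p q = sqrt (scale_sq F p q)"
  by (simp add: Sigma_scale_def scale_sq_def)

text \<open>Removes the discontinuous \<open>sgn\<close> by
  \<open>sgn A / A = 1 / \<bar>A\<bar>\<close>, so that rules for sums, products, roots and inverses
  apply. For \<open>A = 0\<close> both sides are 0 by the convention for division.\<close>

lemma scale_sq_alt:
  "scale_sq F p q = sqrt (coeff_D F p q) * inverse \<bar>coeff_A F p q\<bar> * (1/2)
     - coeff_B F p q * inverse (coeff_A F p q) * (1/2)"
proof (cases "coeff_A F p q = 0")
  case False
  then have "sgn (coeff_A F p q) * inverse (coeff_A F p q) = inverse \<bar>coeff_A F p q\<bar>"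
    by (simp add: sgn_if)
  moreover have "(- b + s * r) / (2 * a) = r * (s * inverse a) * (1/2) - b * inverse a * (1/2)" for a b r s :: real
    by (cases "a = 0") (simp_all add: field_simps)
  ultimately show ?thesis unfolding scale_sq_def by metis
qed (simp add: scale_sq_def)

text \<open>The claim reduces to \<open>sgn A * B < sqrt D\<close>. If \<open>A * B < 0\<close>, the
  left side is negative; if \<open>A * C < 0\<close>, then \<open>D\<close> exceeds
  \<open>B\<^sup>2\<close>.\<close>

lemma scale_sq_pos:
  assumes A: "coeff_A F p q \<noteq> 0" and D: "0 < coeff_D F p q"
    and "(coeff_A F p q * coeff_B F p q < 0 \<and> coeff_A F p q * coeff_C F p q = 0) \<or>
      coeff_A F p q * coeff_C F p q < 0"
  shows "0 < scale_sq F p q"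
proof -
  let ?A = "coeff_A F p q" and ?B = "coeff_B F p q" and ?D = "coeff_D F p q"
  have "sgn ?A * ?B < sqrt ?D"
    using assms(3)
  proof
    assume "?A * ?B < 0 \<and> ?A * coeff_C F p q = 0"
    then have "sgn ?A * ?B < 0" by (auto simp: sgn_if mult_less_0_iff)
    then show ?thesis using D by (meson less_trans real_sqrt_gt_zero)
  next
    assume "?A * coeff_C F p q < 0"
    then have "?B\<^sup>2 < ?D" by (simp add: coeff_D_def mult.assoc)
    then have "\<bar>?B\<bar> < sqrt ?D" using real_sqrt_less_mono by fastforce
    moreover have "sgn ?A * ?B \<le> \<bar>?B\<bar>" by (auto simp: sgn_if)
    ultimately show ?thesis by simp
  qed
  then have "0 < (sqrt ?D - sgn ?A * ?B) * inverse \<bar>?A\<bar>"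
    using A by simp
  also have "\<dots> = 2 * scale_sq F p q"
    using A unfolding scale_sq_alt by (auto simp: sgn_if algebra_simps)
  finally show ?thesis by simp
qed

text \<open>Clearing denominators turns the balance condition into \<open>A X\<^sup>2 + B X + C = 0\<close>; the scale is
  its larger root.\<close>
lemma scale_sq_balance:
  assumes A: "coeff_A F p q \<noteq> 0" and D: "0 \<le> coeff_D F p q" and pos: "0 < scale_sq F p q"
  shows "coeff_a F p + coeff_a F q =
    coeff_b F p / (scale_sq F p q + coeff_c F p) + coeff_b F q / (scale_sq F p q + coeff_c F q)"
proof -
  define X where "X = scale_sq F p q"
  let ?A = "coeff_A F p q" and ?B = "coeff_B F p q" and ?C = "coeff_C F p q"
  \<comment> \<open>Squaring this identity forgets which root was chosen and leaves the
    discriminant.\<close>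
  have "2 * ?A * X + ?B = sgn ?A * sqrt (coeff_D F p q)"
  proof -
    have "2 * a * x + b = s" if "a \<noteq> 0" "x = (- b + s) / (2 * a)" for a b s x :: real
      using that by simp
    from this[OF A X_def[unfolded scale_sq_def]] show ?thesis .
  qed
  then have "(2 * ?A * X + ?B)\<^sup>2 = ?B\<^sup>2 - 4 * ?A * ?C"
    using D A by (simp add: power_mult_distrib coeff_D_def sgn_if)
  moreover have "a * x\<^sup>2 + b * x + c = 0" if "a \<noteq> 0" "(2 * a * x + b)\<^sup>2 = b\<^sup>2 - 4 * a * c" for a b c x :: real
  proof -
    have "4 * a * (a * x\<^sup>2 + b * x + c) = (2 * a * x + b)\<^sup>2 - (b\<^sup>2 - 4 * a * c)"
      by (simp add: power2_eq_square algebra_simps)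
    then show ?thesis using that by simp
  qed
  ultimately have quad: "?A * X\<^sup>2 + ?B * X + ?C = 0" using A by blast
  define x y where "x = X + coeff_c F p" and "y = X + coeff_c F q"
  have xy: "0 < x" "0 < y"
    using pos by (auto simp: x_def y_def X_def coeff_c_def add_pos_nonneg)
  have "(coeff_a F p + coeff_a F q) * (x * y) - (coeff_b F p * y + coeff_b F q * x) = ?A * X\<^sup>2 + ?B * X + ?C"
    by (simp add: x_def y_def coeff_A_def coeff_B_def coeff_C_def power2_eq_square algebra_simps)
  with quad have "(coeff_a F p + coeff_a F q) * (x * y) = coeff_b F p * y + coeff_b F q * x" by simp
  moreover have "k = b / x + e / y" if "k * (x * y) = b * y + e * x" for k b e
    using that xy by (simp add: field_simps)
  ultimately show ?thesis
    unfolding X_def[symmetric] x_def[symmetric] y_def[symmetric] by blast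
qed

section \<open>Compactness of the tube and derivatives of the exact solution\<close>

lemma continuous_pos_lower_bound:
  fixes f :: "'a::topological_space \<Rightarrow> real"
  assumes "compact S" "continuous_on S f" "\<And>z. z \<in> S \<Longrightarrow> 0 < f z"
  shows "\<exists>c>0. \<forall>z\<in>S. c \<le> f z"
proof (cases "S = {}")
  case False
  then show ?thesis using continuous_attains_inf[OF assms(1) False assms(2)] assms(3) by blast
qed (auto intro: exI[of _ 1])

text \<open>The tube is the image of a compact rectangle under the continuous shear
  \<open>(t, r)\<close> to \<open>(t, u t + r)\<close>.\<close>

lemma compact_tube:
  assumes "continuous_on {t0..T} u"
  shows "compact (tube t0 T \<rho> u)"
proof -
  have "tube t0 T \<rho> u = (\<lambda>(t, r). (t, u t + r)) ` ({t0..T} \<times> {-\<rho>..\<rho>})"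
  proof (rule set_eqI, safe)
    fix t x assume "(t, x) \<in> tube t0 T \<rho> u"
    then show "(t, x) \<in> (\<lambda>(t, r). (t, u t + r)) ` ({t0..T} \<times> {-\<rho>..\<rho>})"
      by (intro image_eqI[of _ _ "(t, x - u t)"]) (auto simp: tube_def)
  qed (auto simp: tube_def)
  moreover have "continuous_on ({t0..T} \<times> {-\<rho>..\<rho>}) (\<lambda>(t, r). (t, u t + r))"
    unfolding case_prod_beta'
    by (intro continuous_intros continuous_on_compose2[OF assms]) auto
  ultimately show ?thesis
    by (simp add: compact_continuous_image compact_Times)
qed

lemma has_real_derivative_unique_within_Icc:
  assumes "a < b" "x \<in> {a..b}" "(f has_real_derivative D) (at x within {a..b})"
    "(f has_real_derivative E) (at x within {a..b})"
  shows "D = E"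
  using vector_derivative_unique_within_closed_interval[of a b x f D E] assms
  by (simp add: has_real_derivative_iff_has_vector_derivative)

text \<open>The differential equation is given on the open interval only; continuity extends it to
  the end points. Each further derivative then follows from the chain rule, because derivatives
  within a nondegenerate interval are unique.\<close>

lemma solution_derivatives:
  assumes sol: "ivp_solution \<Omega> F t0 T u0 u" and T: "t0 < T" and \<Omega>: "open \<Omega>" and F: "Ck_plane 3 F \<Omega>"
    and g0: "g 0 = u"
    and g: "\<And>i x. i < 5 \<Longrightarrow> x \<in> {t0..T} \<Longrightarrow> (g i has_real_derivative g (Suc i) x) (at x within {t0..T})"
    and t: "t \<in> {t0..T}"
  shows "g 1 t = F (t, u t)" "g 2 t = Lie F F (t, u t)" "g 3 t = Lie F (Lie F F) (t, u t)"
proof -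
  have u: "continuous_on {t0..T} u" and mem: "\<And>t. t \<in> {t0..T} \<Longrightarrow> (t, u t) \<in> \<Omega>"
    and du: "\<And>t. t \<in> {t0<..<T} \<Longrightarrow> (u has_real_derivative F (t, u t)) (at t)"
    using sol by (auto simp: ivp_solution_def)
  have F1: "Ck_plane 1 F \<Omega>" by (rule Ck_plane_mono[OF F]) simp
  have LF: "Ck_plane 1 (Lie F F) \<Omega>"
    by (rule Ck_plane_Lie[OF \<Omega> F1 Ck_plane_mono[OF F]]) simp
  have cont: "continuous_on {t0..T} (\<lambda>t. F (t, u t))"
    using mem by (intro continuous_on_compose2[OF Ck_plane_continuous[OF F]] continuous_intros u) auto
  have g1c: "continuous_on {t0..T} (g 1)"
    using g[of 1] by (intro DERIV_continuous_on) auto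
  have interior: "g 1 t - F (t, u t) = 0" if "t \<in> {t0<..<T}" for t
  proof -
    have "(u has_real_derivative g 1 t) (at t)"
      using g[of 0 t] that g0 by (simp add: at_within_Icc_at)
    then show ?thesis using DERIV_unique du[OF that] by fastforce
  qed
  have clos: "closure {t0<..<T} = {t0..T}" using T by simp
  have g1: "g 1 t = F (t, u t)" if "t \<in> {t0..T}" for t
  proof -
    have "continuous_on (closure {t0<..<T}) (\<lambda>t. g 1 t - F (t, u t))"
      unfolding clos by (intro continuous_on_diff cont g1c)
    from continuous_constant_on_closure[OF this interior] that
    have "g 1 t - F (t, u t) = 0" unfolding clos by simp
    then show ?thesis by simp
  qed
  have du': "(u has_real_derivative F (t, u t)) (at t within {t0..T})" if "t \<in> {t0..T}" for t
    using g[of 0 t] g0 g1[OF that] that by simp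
  have g2: "g 2 t = Lie F F (t, u t)" if "t \<in> {t0..T}" for t
  proof (rule has_real_derivative_unique_within_Icc[OF T that])
    show "(g 1 has_real_derivative g 2 t) (at t within {t0..T})"
      using g[of 1 t] that by (simp add: numeral_2_eq_2)
    show "(g 1 has_real_derivative Lie F F (t, u t)) (at t within {t0..T})"
      by (rule has_field_derivative_transform_within[OF derivative_along_curve[where u = u and F = F, OF \<Omega> F1 mem[OF that] du'[OF that]], of 1])
         (use that g1 in auto)
  qed
  have g3: "g 3 t = Lie F (Lie F F) (t, u t)" if "t \<in> {t0..T}" for t
  proof (rule has_real_derivative_unique_within_Icc[OF T that])
    show "(g 2 has_real_derivative g 3 t) (at t within {t0..T})"
      using g[of 2 t] that by (simp add: numeral_3_eq_3 numeral_2_eq_2)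
    show "(g 2 has_real_derivative Lie F (Lie F F) (t, u t)) (at t within {t0..T})"
      by (rule has_field_derivative_transform_within[OF derivative_along_curve[where u = u and F = F, OF \<Omega> LF mem[OF that] du'[OF that]], of 1])
         (use that g2 in auto)
  qed
  show "g 1 t = F (t, u t)" "g 2 t = Lie F F (t, u t)" "g 3 t = Lie F (Lie F F) (t, u t)"
    using g1 g2 g3 t by auto
qed

subsection \<open>Convergence of the adaptive specular ellipse method\<close>

lemma conic_mean_alt:
  "conic_mean X \<alpha> \<beta> = (\<alpha> + \<beta>) * (1/2) *
     (1 - (\<alpha> - \<beta>)\<^sup>2 * (inverse (sqrt (X + \<alpha>\<^sup>2) + sqrt (X + \<beta>\<^sup>2)))\<^sup>2)"
  by (simp only: conic_mean_def divide_inverse power_inverse mult_1_left)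

text \<open>The lower bound on \<open>X\<close> keeps both radicands above \<open>c\<close> and the
  sum of the roots above \<open>sqrt c\<close>, so the root and inverse rules apply.\<close>

lemma (in separation) lip_bdd_conic_mean:
  assumes X: "lip_bdd X" and c: "0 < c" "\<And>z w. R z w \<Longrightarrow> c \<le> X z" "\<And>z w. R z w \<Longrightarrow> c \<le> X w"
    and f: "lip_bdd f" and g: "lip_bdd g"
  shows "lip_bdd (\<lambda>z. conic_mean (X z) (f z) (g z))"
proof -
  have ge: "c \<le> x + y\<^sup>2" if "c \<le> x" for x y using that by (simp add: add_increasing2)
  have root: "lip_bdd (\<lambda>z. sqrt (X z + (k z)\<^sup>2))" if "lip_bdd k" for k
    using c by (intro lip_bdd_sqrt[of _ c] lip_bdd_add X lip_bdd_power2 that ge) auto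
  have ge': "sqrt c \<le> \<bar>sqrt (x + y\<^sup>2) + sqrt (x + z\<^sup>2)\<bar>" if "c \<le> x" for x y z
  proof -
    have "sqrt c \<le> sqrt (x + y\<^sup>2)" "0 \<le> sqrt (x + z\<^sup>2)" using ge[OF that] c that by auto
    then show ?thesis by linarith
  qed
  have "lip_bdd (\<lambda>z. inverse (sqrt (X z + (f z)\<^sup>2) + sqrt (X z + (g z)\<^sup>2)))"
    using c by (intro lip_bdd_inverse[of _ "sqrt c"] lip_bdd_add root f g ge') auto
  then show ?thesis
    unfolding conic_mean_alt
    by (intro lip_bdd_mult lip_bdd_diff lip_bdd_add lip_bdd_const lip_bdd_power2 f g)
qed

theorem theorem6p5:
  fixes \<Omega> :: "(real \<times> real) set" and F :: "real \<times> real \<Rightarrow> real"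
    and t0 T u0 \<rho> L \<epsilon>0 :: real and u :: "real \<Rightarrow> real"
  assumes "open \<Omega>" and "0 \<le> t0" and "t0 < T" and "(t0, u0) \<in> \<Omega>"
    and "Ck_plane 3 F \<Omega>"
    and "ivp_solution \<Omega> F t0 T u0 u"
    and "\<And>v t. ivp_solution \<Omega> F t0 T u0 v \<Longrightarrow> t \<in> {t0..T} \<Longrightarrow> v t = u t"
    and "Ck_interval 5 u t0 T"
    and "0 < \<rho>" and "0 \<le> L" and "tube t0 T \<rho> u \<subseteq> \<Omega>"
    and "\<And>t x y. (t, x) \<in> tube t0 T \<rho> u \<Longrightarrow> (t, y) \<in> tube t0 T \<rho> u \<Longrightarrow>
           \<bar>F (t, x) - F (t, y)\<bar> \<le> L * \<bar>x - y\<bar>"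
    and "0 < \<epsilon>0"
    and "\<And>t x s y. (t, x) \<in> tube t0 T \<rho> u \<Longrightarrow> (s, y) \<in> tube t0 T \<rho> u \<Longrightarrow>
           0 \<le> s - t \<Longrightarrow> s - t \<le> \<epsilon>0 \<Longrightarrow>
           coeff_A F (t, x) (s, y) \<noteq> 0 \<and>
           ((coeff_D F (t, x) (s, y) > 0 \<and>
             coeff_A F (t, x) (s, y) * coeff_B F (t, x) (s, y) < 0 \<and>
             coeff_A F (t, x) (s, y) * coeff_C F (t, x) (s, y) = 0) \<or>
            (coeff_D F (t, x) (s, y) > 0 \<and>
             coeff_A F (t, x) (s, y) * coeff_C F (t, x) (s, y) < 0))"
  shows "\<exists>H C\<^sub>g. 0 < H \<and> H \<le> \<epsilon>0 \<and> 0 < C\<^sub>g \<and>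
    (\<forall>h. 0 < h \<and> h \<le> H \<longrightarrow>
      (\<exists>v. adaptive_run F t0 T \<rho> u h v \<and>
           (\<forall>w. adaptive_run F t0 T \<rho> u h w \<longrightarrow> (\<forall>n\<le>num_steps t0 T h. w n = v n)) \<and>
           Max ((\<lambda>n. \<bar>u (grid t0 h n) - v n\<bar>) ` {0..num_steps t0 T h}) \<le> C\<^sub>g * h ^ 4))"
proof -
  note \<Omega> = assms(1) and T = assms(3) and F3 = assms(5) and sol = assms(6) and \<rho> = assms(9)
    and tube_sub = assms(11) and \<epsilon> = assms(13) and E5 = assms(14)
  define U where "U = tube t0 T \<rho> u"
  \<comment> \<open>The admissible pairs, cut out of \<open>U \<times> U\<close> by closed
    conditions. Compactness of \<open>Z\<close> is what turns the pointwise hypotheses into uniform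
    constants.\<close>
  define Z where "Z = {z \<in> U \<times> U. 0 \<le> fst (snd z) - fst (fst z) \<and> fst (snd z) - fst (fst z) \<le> \<epsilon>0}"
  define X where "X z = scale_sq F (fst z) (snd z)" for z
  define \<Phi> where "\<Phi> p q = scaled_mean (Sigma_scale F p q) (F q) (F p)" for p q
  have u_cont: "continuous_on {t0..T} u" using sol by (simp add: ivp_solution_def)
  have U: "compact U" "U \<subseteq> \<Omega>" using compact_tube[OF u_cont] tube_sub by (auto simp: U_def)
  have Z: "compact Z"
  proof -
    have "Z = (U \<times> U) \<inter> {z. 0 \<le> fst (snd z) - fst (fst z) \<and> fst (snd z) - fst (fst z) \<le> \<epsilon>0}"
      by (auto simp: Z_def)
    then show ?thesis
      using U(1) by (auto intro!: compact_Int_closed compact_Times closed_Collect_conj closed_Collect_le continuous_intros)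
  qed
  have ZU: "fst z \<in> U" "snd z \<in> U" if "z \<in> Z" for z using that by (auto simp: Z_def)

  \<comment> \<open>Each Lie derivative costs one order of smoothness. Starting from order 3, the
    second one is still of order 1, as the Lipschitz bound for \<open>coeff_a\<close>
    requires.\<close>
  have F1: "Ck_plane 1 F \<Omega>" by (rule Ck_plane_mono[OF F3]) simp
  have F2: "Ck_plane (Suc 1) F \<Omega>" by (rule Ck_plane_mono[OF F3]) simp
  have LF2: "Ck_plane (Suc 1) (Lie F F) \<Omega>"
    by (rule Ck_plane_Lie[OF \<Omega> F2]) (rule Ck_plane_mono[OF F3], simp)
  have LF1: "Ck_plane 1 (Lie F F) \<Omega>" by (rule Ck_plane_mono[OF LF2]) simp
  have LLF1: "Ck_plane 1 (Lie F (Lie F F)) \<Omega>" by (rule Ck_plane_Lie[OF \<Omega> F1 LF2])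

  have E5': "coeff_A F (fst z) (snd z) \<noteq> 0" "0 < coeff_D F (fst z) (snd z)" "0 < X z" if "z \<in> Z" for z
  proof -
    obtain t x s y where z: "z = ((t, x), (s, y))" by (metis surj_pair)
    have "(t, x) \<in> tube t0 T \<rho> u" "(s, y) \<in> tube t0 T \<rho> u" "0 \<le> s - t" "s - t \<le> \<epsilon>0"
      using that by (auto simp: Z_def U_def z)
    from E5[OF this] show "coeff_A F (fst z) (snd z) \<noteq> 0" "0 < coeff_D F (fst z) (snd z)" "0 < X z"
      unfolding X_def by (auto simp: z intro!: scale_sq_pos)
  qed

  have cont: "continuous_on Z (\<lambda>z. G (fst z))" "continuous_on Z (\<lambda>z. G (snd z))" if "Ck_plane 1 G \<Omega>" for G
    using ZU U(2) by (auto intro!: continuous_on_compose2[OF Ck_plane_continuous[OF that]] continuous_intros)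
  note cont_intros = cont[OF F1] cont[OF LF1] cont[OF LLF1]
  note coeff_defs = coeff_a_def coeff_b_def coeff_c_def
  have A_cont: "continuous_on Z (\<lambda>z. coeff_A F (fst z) (snd z))"
    unfolding coeff_A_def coeff_defs by (intro continuous_intros cont_intros)
  have B_cont: "continuous_on Z (\<lambda>z. coeff_B F (fst z) (snd z))"
    unfolding coeff_B_def coeff_defs by (intro continuous_intros cont_intros)
  have C_cont: "continuous_on Z (\<lambda>z. coeff_C F (fst z) (snd z))"
    unfolding coeff_C_def coeff_defs by (intro continuous_intros cont_intros)
  have D_cont: "continuous_on Z (\<lambda>z. coeff_D F (fst z) (snd z))"
    unfolding coeff_D_def by (intro continuous_intros A_cont B_cont C_cont)
  have X_cont: "continuous_on Z X"
    unfolding X_def scale_sq_alt using E5'(1)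
    by (intro continuous_intros A_cont B_cont D_cont) auto
  \<comment> \<open>The strict inequalities on \<open>Z\<close> become uniform lower bounds, which
    the root and inverse rules below consume.\<close>
  obtain cA where cA: "0 < cA" "\<And>z. z \<in> Z \<Longrightarrow> cA \<le> \<bar>coeff_A F (fst z) (snd z)\<bar>"
    using continuous_pos_lower_bound[OF Z continuous_on_rabs[OF A_cont]] E5'(1) by (metis zero_less_abs_iff)
  obtain cD where cD: "0 < cD" "\<And>z. z \<in> Z \<Longrightarrow> cD \<le> coeff_D F (fst z) (snd z)"
    using continuous_pos_lower_bound[OF Z D_cont] E5'(2) by (metis)
  obtain cX where cX: "0 < cX" "\<And>z. z \<in> Z \<Longrightarrow> cX \<le> X z"
    using continuous_pos_lower_bound[OF Z X_cont] E5'(3) by (metis)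
  have \<Phi>_eq: "\<Phi> (fst z) (snd z) = conic_mean (X z) (F (snd z)) (F (fst z))" if "z \<in> Z" for z
    unfolding \<Phi>_def Sigma_scale_eq X_def using E5'(3)[OF that] by (intro scaled_mean_conv_conic_mean) (simp add: X_def)

  define R where "R z w \<longleftrightarrow> z \<in> Z \<and> w \<in> Z \<and> fst (fst z) = fst (fst w) \<and> fst (snd z) = fst (snd w)"
    for z w :: "(real \<times> real) \<times> (real \<times> real)"
  define d where "d z w = \<bar>snd (fst z) - snd (fst w)\<bar> + \<bar>snd (snd z) - snd (snd w)\<bar>"
    for z w :: "(real \<times> real) \<times> (real \<times> real)"
  interpret separation R d by unfold_locales (simp add: d_def)
  have RZ: "z \<in> Z" "w \<in> Z" if "R z w" for z w using that by (auto simp: R_def)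
  \<comment> \<open>Pairs related by \<open>R\<close> share both times, so Lipschitz continuity in
    the second variable suffices.\<close>
  have basic: "lip_bdd (\<lambda>z. G (fst z))" "lip_bdd (\<lambda>z. G (snd z))" if G: "Ck_plane 1 G \<Omega>" for G
  proof -
    have "continuous_on U G" using Ck_plane_continuous[OF G] U(2) by (rule continuous_on_subset)
    from compact_imp_bounded[OF compact_continuous_image[OF this U(1)]]
    obtain B where B: "\<And>p. p \<in> U \<Longrightarrow> \<bar>G p\<bar> \<le> B" by (auto simp: bounded_iff)
    obtain M where M: "\<And>t x y. (t, x) \<in> U \<Longrightarrow> (t, y) \<in> U \<Longrightarrow> \<bar>G (t, x) - G (t, y)\<bar> \<le> M * \<bar>x - y\<bar>"
      using Ck_plane_Lipschitz_in_x[OF \<Omega> G, of t0 T \<rho> u] U unfolding U_def by blast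
    have M': "\<bar>G p - G q\<bar> \<le> \<bar>M\<bar> * \<bar>snd p - snd q\<bar>" if "p \<in> U" "q \<in> U" "fst p = fst q" for p q
    proof -
      have "\<bar>G p - G q\<bar> \<le> M * \<bar>snd p - snd q\<bar>"
        using M[of "fst p" "snd p" "snd q"] that by (metis prod.collapse)
      also have "\<dots> \<le> \<bar>M\<bar> * \<bar>snd p - snd q\<bar>" by (intro mult_right_mono) auto
      finally show ?thesis .
    qed
    have d1: "\<bar>M\<bar> * \<bar>snd (fst z) - snd (fst w)\<bar> \<le> \<bar>M\<bar> * d z w"
      and d2: "\<bar>M\<bar> * \<bar>snd (snd z) - snd (snd w)\<bar> \<le> \<bar>M\<bar> * d z w" for z w
      by (auto simp: d_def intro!: mult_left_mono)
    show "lip_bdd (\<lambda>z. G (fst z))"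
      by (rule lip_bddI[where B = B and L = "\<bar>M\<bar>"])
         (auto simp: R_def intro!: B ZU order_trans[OF M' d1])
    show "lip_bdd (\<lambda>z. G (snd z))"
      by (rule lip_bddI[where B = B and L = "\<bar>M\<bar>"])
         (auto simp: R_def intro!: B ZU order_trans[OF M' d2])
  qed
  note lip_intros = lip_bdd_add lip_bdd_diff lip_bdd_mult lip_bdd_power2 lip_bdd_const
  note lip_basic = basic[OF F1] basic[OF LF1] basic[OF LLF1]
  have A_lip: "lip_bdd (\<lambda>z. coeff_A F (fst z) (snd z))"
    unfolding coeff_A_def coeff_defs by (intro lip_intros lip_basic)
  have B_lip: "lip_bdd (\<lambda>z. coeff_B F (fst z) (snd z))"
    unfolding coeff_B_def coeff_defs by (intro lip_intros lip_basic)
  have C_lip: "lip_bdd (\<lambda>z. coeff_C F (fst z) (snd z))"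
    unfolding coeff_C_def coeff_defs by (intro lip_intros lip_basic)
  have D_lip: "lip_bdd (\<lambda>z. coeff_D F (fst z) (snd z))"
    unfolding coeff_D_def by (intro lip_intros A_lip B_lip C_lip)
  have "lip_bdd (\<lambda>z. sqrt (coeff_D F (fst z) (snd z)))"
    using cD RZ by (intro lip_bdd_sqrt[OF D_lip, of cD]) auto
  moreover have "lip_bdd (\<lambda>z. inverse \<bar>coeff_A F (fst z) (snd z)\<bar>)"
    using cA RZ by (intro lip_bdd_inverse[OF lip_bdd_abs[OF A_lip], of cA]) auto
  moreover have "lip_bdd (\<lambda>z. inverse (coeff_A F (fst z) (snd z)))"
    using cA RZ by (intro lip_bdd_inverse[OF A_lip, of cA]) auto
  ultimately have X_lip: "lip_bdd X"
    unfolding X_def scale_sq_alt by (intro lip_intros B_lip)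
  have "lip_bdd (\<lambda>z. conic_mean (X z) (F (snd z)) (F (fst z)))"
    using cX RZ by (intro lip_bdd_conic_mean[OF X_lip, of cX] lip_basic) auto
  then have "lip_bdd (\<lambda>z. \<Phi> (fst z) (snd z))"
    by (rule lip_bdd_cong) (use \<Phi>_eq RZ in auto)
  then obtain M where M0: "0 \<le> M"
    and "\<forall>z w. R z w \<longrightarrow> \<bar>\<Phi> (fst z) (snd z)\<bar> \<le> M \<and> \<bar>\<Phi> (fst w) (snd w)\<bar> \<le> M \<and>
      \<bar>\<Phi> (fst z) (snd z) - \<Phi> (fst w) (snd w)\<bar> \<le> M * d z w"
    unfolding lip_bdd_def by (elim exE conjE)
  then have M: "\<bar>\<Phi> (fst z) (snd z) - \<Phi> (fst w) (snd w)\<bar> \<le> M * d z w" if "R z w" for z w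
    using that by blast

  obtain g where g0: "g 0 = u"
    and g: "\<And>i x. i < 5 \<Longrightarrow> x \<in> {t0..T} \<Longrightarrow> (g i has_real_derivative g (Suc i) x) (at x within {t0..T})"
    and g_cont: "\<And>i. i \<le> 5 \<Longrightarrow> continuous_on {t0..T} (g i)"
    using Ck_interval_derivatives[OF assms(8)] by blast
  have g123: "g 1 t = F (t, u t)" "g 2 t = Lie F F (t, u t)" "g 3 t = Lie F (Lie F F) (t, u t)"
    if "t \<in> {t0..T}" for t
    by (rule solution_derivatives[where g = g, OF sol T \<Omega> F3 g0 _ that]; rule g; assumption)+
  obtain B where B: "\<And>i x. i \<le> 5 \<Longrightarrow> x \<in> {t0..T} \<Longrightarrow> \<bar>g i x\<bar> \<le> B"
    using continuous_functions_uniform_bound[where f = g and k = 5, OF compact_Icc g_cont] by blast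
  have B0: "0 \<le> B" using B[of 0 t0] T by auto
  \<comment> \<open>The constant of \<open>conic_mean_truncation\<close> with the derivative bound
    \<open>B\<close> and the lower bound \<open>cX\<close> for the squared scale.\<close>
  define K where "K = B + B ^ 3 / cX + B ^ 5 / cX ^ 2 + B ^ 7 / cX ^ 3"
  have K: "0 \<le> K" using B0 cX(1) by (simp add: K_def)

  have consistent: "\<bar>u (t + h) - u t - h * \<Phi> (t, u t) (t + h, u (t + h))\<bar> \<le> K * h ^ Suc 4"
    if h: "0 < h" "h \<le> \<epsilon>0" and t: "t0 \<le> t" "t + h \<le> T" for t h
  proof -
    have mem: "t \<in> {t0..T}" "t + h \<in> {t0..T}" using h t by auto
    let ?z = "((t, u t), (t + h, u (t + h)))"
    have z: "?z \<in> Z" using mem h \<rho> by (auto simp: Z_def U_def tube_def)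
    \<comment> \<open>Along the exact solution the coefficients are derivatives of \<open>u\<close>,
      so the equation for the scale becomes the hypothesis \<open>scale\<close> of the truncation
      lemma.\<close>
    have balance: "g 3 t + g 3 (t + h)
        = 3 * g 1 t * (g 2 t)\<^sup>2 / (X ?z + (g 1 t)\<^sup>2) + 3 * g 1 (t + h) * (g 2 (t + h))\<^sup>2 / (X ?z + (g 1 (t + h))\<^sup>2)"
      using scale_sq_balance[of F "(t, u t)" "(t + h, u (t + h))"] E5'[OF z]
      unfolding g123[OF mem(1)] g123[OF mem(2)] by (simp add: X_def coeff_defs)
    have "\<bar>u (t + h) - u t - h * conic_mean (X ?z) (g 1 (t + h)) (g 1 t)\<bar> \<le> K * h ^ 5"
      unfolding K_def
    proof (rule conic_mean_truncation[OF cX(1) cX(2)[OF z] B0 _ _ _ _ _ _ _ _ _ balance])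
      note defect = corrected_trapezoid_defect[of t0 T g B t h, OF g B mem]
      show "\<bar>g 1 (t + h)\<bar> \<le> B" "\<bar>g 1 t\<bar> \<le> B" "\<bar>g 2 t\<bar> \<le> B" "\<bar>g 2 (t + h)\<bar> \<le> B"
        using B mem by auto
      show "0 \<le> h" using h by simp
      show "\<bar>g 1 (t + h) - g 1 t\<bar> \<le> B * h" using defect(3)[of 1] h by simp
      show "\<bar>g 2 t - g 2 (t + h)\<bar> \<le> B * h" using defect(3)[of 2] h by (simp add: abs_minus_commute)
      show "\<bar>g 1 (t + h) - g 1 t - h / 2 * (g 2 t + g 2 (t + h))\<bar> \<le> B * h ^ 3"
        using defect(2) h by simp
      show "\<bar>u (t + h) - u t - h / 2 * (g 1 (t + h) + g 1 t) + h ^ 3 / 24 * (g 3 t + g 3 (t + h))\<bar> \<le> B * h ^ 5"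
        using defect(1) h by (simp add: g0)
    qed
    moreover have "\<Phi> (t, u t) (t + h, u (t + h)) = conic_mean (X ?z) (g 1 (t + h)) (g 1 t)"
      unfolding g123(1)[OF mem(1)] g123(1)[OF mem(2)] using \<Phi>_eq[OF z] by simp
    ultimately show ?thesis by simp
  qed

  have lip: "\<bar>\<Phi> (t, x) (s, y) - \<Phi> (t, x') (s, y')\<bar> \<le> M * (\<bar>x - x'\<bar> + \<bar>y - y'\<bar>)"
    if "(t, x) \<in> tube t0 T \<rho> u" "(s, y) \<in> tube t0 T \<rho> u"
      "(t, x') \<in> tube t0 T \<rho> u" "(s, y') \<in> tube t0 T \<rho> u" "0 \<le> s - t" "s - t \<le> \<epsilon>0" for t s x y x' y'
    using M[of "((t, x), (s, y))" "((t, x'), (s, y'))"] that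
    by (simp add: R_def d_def Z_def U_def)

  have run_iff: "adaptive_run F t0 T \<rho> u h v \<longleftrightarrow> v 0 = u t0 \<and>
      (\<forall>n<num_steps t0 T h. v (Suc n) =
         v n + h * \<Phi> (grid t0 h n, v n) (grid t0 h (Suc n), v (Suc n))) \<and>
      (\<forall>n\<le>num_steps t0 T h. (grid t0 h n, v n) \<in> tube t0 T \<rho> u)" for h v
    unfolding adaptive_run_def ellipse_method_def \<Phi>_def by (rule refl)
  \<comment> \<open>The local error of order 5 corresponds to \<open>p = 4\<close> in the general
    convergence theorem.\<close>
  have "\<exists>H C. 0 < H \<and> H \<le> \<epsilon>0 \<and> 0 < C \<and> (\<forall>h. 0 < h \<and> h \<le> H \<longrightarrow>
      (\<exists>v. adaptive_run F t0 T \<rho> u h v \<and>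
         (\<forall>w. adaptive_run F t0 T \<rho> u h w \<longrightarrow> (\<forall>n\<le>num_steps t0 T h. w n = v n)) \<and>
         (\<forall>n\<le>num_steps t0 T h. \<bar>u (grid t0 h n) - v n\<bar> \<le> C * h ^ 4)))"
    unfolding run_iff
  proof (rule implicit_one_step_convergence[where \<Phi> = \<Phi> and p = 4, OF T \<rho> \<epsilon> M0 K])
    show "0 < (4::nat)" by simp
  qed (rule lip consistent; assumption)+
  then obtain H C where HC: "0 < H" "H \<le> \<epsilon>0" "0 < C"
    and conv: "\<And>h. 0 < h \<Longrightarrow> h \<le> H \<Longrightarrow>
      \<exists>v. adaptive_run F t0 T \<rho> u h v \<and>
         (\<forall>w. adaptive_run F t0 T \<rho> u h w \<longrightarrow> (\<forall>n\<le>num_steps t0 T h. w n = v n)) \<and>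
         (\<forall>n\<le>num_steps t0 T h. \<bar>u (grid t0 h n) - v n\<bar> \<le> C * h ^ 4)"
    by blast
  have "\<exists>v. adaptive_run F t0 T \<rho> u h v \<and>
         (\<forall>w. adaptive_run F t0 T \<rho> u h w \<longrightarrow> (\<forall>n\<le>num_steps t0 T h. w n = v n)) \<and>
         Max ((\<lambda>n. \<bar>u (grid t0 h n) - v n\<bar>) ` {0..num_steps t0 T h}) \<le> C * h ^ 4"
    if "0 < h" "h \<le> H" for h
  proof -
    obtain v where v: "adaptive_run F t0 T \<rho> u h v"
      "\<forall>w. adaptive_run F t0 T \<rho> u h w \<longrightarrow> (\<forall>n\<le>num_steps t0 T h. w n = v n)"
      "\<forall>n\<le>num_steps t0 T h. \<bar>u (grid t0 h n) - v n\<bar> \<le> C * h ^ 4"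
      using conv[OF \<open>0 < h\<close> \<open>h \<le> H\<close>] by blast
    have "Max ((\<lambda>n. \<bar>u (grid t0 h n) - v n\<bar>) ` {0..num_steps t0 T h}) \<le> C * h ^ 4"
      using v(3) by (subst Max_le_iff) auto
    then show ?thesis using v by blast
  qed
  then show ?thesis using HC by blast
qed

end
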